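(* Let $\mathbb{F}$ be a field and let $\mathcal{K}\colon K_0\to K_1\to\dots\to K_N$ be a finite sequence of topological spaces and continuous maps with $\dim H_p(K_i;\mathbb{F})<\infty$ for all $p$ and $i$. For each $0\le i\le N$ fix a transferred $A_\infty$-coalgebra structure $\{\Delta^i_m\}_{m\ge 1}$ on $H_*(K_i)=H_*(K_i;\mathbb{F})$. Fix integers $p\ge 0$ and $n\ge 1$, and let $\Delta^i$ denote the restriction of $\Delta^i_n$ to $H_p(K_i)$. If $f_p^{i,i+1}(\operatorname{Ker}\Delta^i)\subseteq\operatorname{Ker}\Delta^{i+1}$ for all $0\le i<N$, then there exists a unique multiset $M_{p,n}$ of intervals of the form $[i,j)$ for $0\le i<j\le N$ and intervals of the form $[i,\infty)$ for $0\le i\le N$ (with integer endpoints) such that for all $0\le i\le j\le N$ the dimension $\dim(\Delta_n)_p^{i,j}(\mathcal{K})$ equals the number of intervals in $M_{p,n}$ (counted with multiplicities) which contain the interval $[i,j]$. In particular, $\dim\operatorname{Ker}\bigl(\Delta^i_n|_{H_p(K_i)}\bigr)$ equals the number of intervals in $M_{p,n}$ (counted with multiplicities) which contain the integer $i$.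
   Context: For $0\le i\le j\le N$, $f_p^{i,j}\colon H_p(K_i)\to H_p(K_j)$ denotes the linear map induced in homology by the composition $K_i\to K_{i+1}\to\dots\to K_j$ (the identity if $i=j$). For $0\le i\le j\le N$, $p\ge 0$, $n\ge 1$, the $p$-th $\Delta_n$-persistent group between $K_i$ and $K_j$ is the vector space $$(\Delta_n)_p^{i,j}(\mathcal{K}):=f_p^{i,j}\Bigl(\bigcap_{k=i}^{j}\operatorname{Ker}\bigl(\Delta_n^k\circ f_p^{i,k}\bigr)\Bigr)\subseteq H_p(K_j),$$ i.e. the image of the restriction of $f^{i,j}_p$ to $\bigcap_{k=i}^{j}\operatorname{Ker}(\Delta_n^k\circ f_p^{i,k})$. An $A_\infty$-coalgebra structure on a graded vector space $C$ is a family of linear maps $\Delta_n\colon C\to C^{\otimes n}$ ($n\ge 1$) of degree $n-2$ such that for every $n\ge 1$ $$\sum_{i=1}^n\sum_{j=0}^{n-i}(-1)^{i+j+ij}\bigl(1^{\otimes (n-i-j)}\otimes\Delta_i\otimes 1^{\otimes j}\bigr)\Delta_{n-i+1}=0$$ (with Koszul signs). It is minimal if $\Delta_1=0$. Equivalently, with $(s^{-1}C)_p=C_{p+1}$, the maps $d_n=-(s^{-1})^{\otimes n}\circ\Delta_n\circ s$ assemble into a degree $-1$ derivation $d=\sum_n d_n$ with $d^2=0$ on the complete tensor algebra $\widehat T(s^{-1}C)=\prod_{n\ge 1}(s^{-1}C)^{\otimes n}$. A morphism of $A_\infty$-coalgebras $C\to C'$ is a family of linear maps $f_{(k)}\colon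 C\to (C')^{\otimes k}$, $k\ge 1$, of degree $k-1$, such that the algebra morphism $\widehat T(s^{-1}C)\to\widehat T(s^{-1}C')$ determined by $s^{-1}c\mapsto\sum_{k\ge 1}(s^{-1})^{\otimes k}f_{(k)}(c)$ commutes with the differentials; it is a quasi-isomorphism if $f_{(1)}$ induces an isomorphism in homology (with respect to $\Delta_1,\Delta_1'$). A transferred $A_\infty$-coalgebra structure on $H_*(X)$ (induced by the space $X$) is a minimal $A_\infty$-coalgebra structure on the graded vector space $H_*(X)$ that is quasi-isomorphic to $(C_*(X),\{\partial,\Delta,0,0,\dots\})$, where $(C_*(X),\partial)$ is the singular chain complex of $X$ with coefficients in $\mathbb{F}$ and $\Delta$ is a (coassociative) approximation to the diagonal, e.g. the Alexander–Whitney comultiplication. *)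

theory Defs
  imports "HOL-Homology.Homology" "HOL-Algebra.QuotRing" "Jordan_Normal_Form.VS_Connect"
begin

text \<open>Vector spaces are \<^typ>\<open>('k, 'v) module\<close> records over the field
  \<^term>\<open>class_ring :: 'k::field ring\<close>; dimensions are \<^const>\<open>vectorspace.dim\<close> and
  \<^const>\<open>vectorspace.fin_dim\<close>.\<close>

section \<open>Free and quotient vector spaces\<close>

definition pm_scale :: "'k::field \<Rightarrow> ('s \<Rightarrow>\<^sub>0 'k) \<Rightarrow> ('s \<Rightarrow>\<^sub>0 'k)" where
  "pm_scale c x = Poly_Mapping.map ((*) c) x"

text \<open>The multiplicative fields of a record that is only used as a vector space are junk.\<close>

definition free_vs :: "'s set \<Rightarrow> ('k::field, 's \<Rightarrow>\<^sub>0 'k) module" where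
  "free_vs S = \<lparr>carrier = {x. Poly_Mapping.keys x \<subseteq> S}, mult = undefined, one = undefined,
     zero = 0, add = (+), smult = pm_scale\<rparr>"

definition lin_ext :: "('s \<Rightarrow> ('t \<Rightarrow>\<^sub>0 'k)) \<Rightarrow> ('s \<Rightarrow>\<^sub>0 'k::field) \<Rightarrow> ('t \<Rightarrow>\<^sub>0 'k)" where
  "lin_ext \<phi> x = (\<Sum>s\<in>Poly_Mapping.keys x. pm_scale (Poly_Mapping.lookup x s) (\<phi> s))"

text \<open>The quotient by a subspace \<^term>\<open>N\<close>; the ring part is that of \<^const>\<open>FactRing\<close>.
  Scaling by zero maps a coset to a single vector, hence the summand \<^term>\<open>N\<close> in
  the scalar multiplication.\<close>

definition quot_vs :: "('k, 'v, 'm) module_scheme \<Rightarrow> 'v set \<Rightarrow> ('k, 'v set) module" where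
  "quot_vs M N = \<lparr>carrier = a_rcosets\<^bsub>M\<^esub> N, mult = rcoset_mult M N, one = N +>\<^bsub>M\<^esub> \<one>\<^bsub>M\<^esub>,
     zero = N, add = set_add M, smult = (\<lambda>c A. N <+>\<^bsub>M\<^esub> (smult M c ` A))\<rparr>"

definition lin_ker ::
  "('k, 'v, 'm) module_scheme \<Rightarrow> ('k, 'w, 'n) module_scheme \<Rightarrow> ('v \<Rightarrow> 'w) \<Rightarrow> 'v set" where
  "lin_ker V W f = {v \<in> carrier V. f v = \<zero>\<^bsub>W\<^esub>}"


section \<open>The tensor algebra of a graded vector space\<close>

text \<open>A graded vector space is the family of its homogeneous parts, and a linear map of degree
  \<open>e\<close> is a family of linear maps indexed by the degree of the source.\<close>

type_synonym ('k, 'v) graded = "int \<Rightarrow> ('k, 'v) module"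

text \<open>Elements of the tensor algebra are classes of formal linear combinations of words whose
  letters \<open>(p, v)\<close> are homogeneous vectors tagged with their degree.\<close>

type_synonym ('k, 'v) tensor = "((int \<times> 'v) list \<Rightarrow>\<^sub>0 'k) set"

definition words :: "('k, 'v) graded \<Rightarrow> (int \<times> 'v) list set" where
  "words V = {w. \<forall>(p, v) \<in> set w. v \<in> carrier (V p)}"

definition concat_mult ::
  "('x list \<Rightarrow>\<^sub>0 'k::field) \<Rightarrow> ('x list \<Rightarrow>\<^sub>0 'k) \<Rightarrow> ('x list \<Rightarrow>\<^sub>0 'k)" where
  "concat_mult x y = (\<Sum>u\<in>Poly_Mapping.keys x. \<Sum>w\<in>Poly_Mapping.keys y.
     Poly_Mapping.single (u @ w) (Poly_Mapping.lookup x u * Poly_Mapping.lookup y w))"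

definition word_alg :: "('k::field, 'v) graded \<Rightarrow> ('k, (int \<times> 'v) list \<Rightarrow>\<^sub>0 'k) module" where
  "word_alg V = (free_vs (words V))\<lparr>mult := concat_mult, one := Poly_Mapping.single [] 1\<rparr>"

definition tensor_rels :: "('k::field, 'v) graded \<Rightarrow> ((int \<times> 'v) list \<Rightarrow>\<^sub>0 'k) set" where
  "tensor_rels V = module.span class_ring (word_alg V)
     ({Poly_Mapping.single (u @ [(p, v \<oplus>\<^bsub>V p\<^esub> v')] @ w) 1
         - Poly_Mapping.single (u @ [(p, v)] @ w) 1 - Poly_Mapping.single (u @ [(p, v')] @ w) 1
       | u w p v v'. u \<in> words V \<and> w \<in> words V \<and> v \<in> carrier (V p) \<and> v' \<in> carrier (V p)}
     \<union> {Poly_Mapping.single (u @ [(p, c \<odot>\<^bsub>V p\<^esub> v)] @ w) 1 - Poly_Mapping.single (u @ [(p, v)] @ w) c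
       | u w p v c. u \<in> words V \<and> w \<in> words V \<and> v \<in> carrier (V p)})"

definition tensor_alg :: "('k::field, 'v) graded \<Rightarrow> ('k, ('k, 'v) tensor) module" where
  "tensor_alg V = quot_vs (word_alg V) (tensor_rels V)"

definition tensor_class :: "('k::field, 'v) graded \<Rightarrow> ((int \<times> 'v) list \<Rightarrow>\<^sub>0 'k) \<Rightarrow> ('k, 'v) tensor" where
  "tensor_class V x = tensor_rels V +>\<^bsub>word_alg V\<^esub> x"

text \<open>The part of degree \<open>d\<close> of the \<open>n\<close>-th tensor power, as a subspace of the tensor algebra.\<close>

definition tensor_pow :: "('k::field, 'v) graded \<Rightarrow> nat \<Rightarrow> int \<Rightarrow> ('k, ('k, 'v) tensor) module" where
  "tensor_pow V n d = (tensor_alg V)\<lparr>carrier :=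
     tensor_class V ` {x. Poly_Mapping.keys x \<subseteq>
       {w \<in> words V. length w = n \<and> sum_list (map fst w) = d}}\<rparr>"

text \<open>The isomorphism of \<^term>\<open>V\<close> with its first tensor power, and its inverse.\<close>

definition letter :: "('k::field, 'v) graded \<Rightarrow> int \<Rightarrow> 'v \<Rightarrow> ('k, 'v) tensor" where
  "letter V p v = tensor_class V (Poly_Mapping.single [(p, v)] 1)"

definition unletter :: "('k::field, 'v) graded \<Rightarrow> int \<Rightarrow> ('k, 'v) tensor \<Rightarrow> 'v" where
  "unletter V p = the_inv_into (carrier (V p)) (letter V p)"

definition ksign :: "int \<Rightarrow> 'k::field" where
  "ksign e = (if even e then 1 else - 1)"

text \<open>Given pairs \<open>gs = [(e\<^sub>1, g\<^sub>1), \<dots>, (e\<^sub>n, g\<^sub>n)]\<close> of linear maps \<open>g\<^sub>j\<close> of degree \<open>e\<^sub>j\<close> from \<open>V\<close> to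
  the tensor algebra of \<open>W\<close>, \<open>tensor_map W gs\<close> is \<open>g\<^sub>1 \<otimes> \<dots> \<otimes> g\<^sub>n\<close> on the \<open>n\<close>-th tensor power of \<open>V\<close>
  (and zero on the other ones), with the Koszul sign
  \<open>(-1) ^ (\<Sum>i<j. e\<^sub>j * deg v\<^sub>i)\<close> on \<open>v\<^sub>1 \<otimes> \<dots> \<otimes> v\<^sub>n\<close>. All representatives of a class have the same
  image, so \<^const>\<open>the_elem\<close> selects it.\<close>

definition tensor_map_word ::
  "('k::field, 'w) graded \<Rightarrow> (int \<times> (int \<Rightarrow> 'v \<Rightarrow> ('k, 'w) tensor)) list
     \<Rightarrow> (int \<times> 'v) list \<Rightarrow> ('k, 'w) tensor" where
  "tensor_map_word W gs w =
     (if length w = length gs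
      then ksign (\<Sum>j<length gs. \<Sum>i<j. fst (gs ! j) * fst (w ! i)) \<odot>\<^bsub>tensor_alg W\<^esub>
             foldr (mult (tensor_alg W))
               (map2 (\<lambda>(e, g) (p, v). g p v) gs w) \<one>\<^bsub>tensor_alg W\<^esub>
      else \<zero>\<^bsub>tensor_alg W\<^esub>)"

definition tensor_map ::
  "('k::field, 'w) graded \<Rightarrow> (int \<times> (int \<Rightarrow> 'v \<Rightarrow> ('k, 'w) tensor)) list
     \<Rightarrow> ('k, 'v) tensor \<Rightarrow> ('k, 'w) tensor" where
  "tensor_map W gs A = the_elem ((\<lambda>x. \<Oplus>\<^bsub>tensor_alg W\<^esub>w\<in>Poly_Mapping.keys x.
     Poly_Mapping.lookup x w \<odot>\<^bsub>tensor_alg W\<^esub> tensor_map_word W gs w) ` A)"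

definition one_op_one ::
  "('k::field, 'v) graded \<Rightarrow> nat \<Rightarrow> int \<Rightarrow> (int \<Rightarrow> 'v \<Rightarrow> ('k, 'v) tensor) \<Rightarrow> nat
     \<Rightarrow> ('k, 'v) tensor \<Rightarrow> ('k, 'v) tensor" where
  "one_op_one V a e g b =
     tensor_map V (replicate a (0, letter V) @ [(e, g)] @ replicate b (0, letter V))"


section \<open>Homology of graded vector spaces with a differential\<close>

definition cycles :: "('k, 'v) graded \<Rightarrow> (int \<Rightarrow> 'v \<Rightarrow> 'v) \<Rightarrow> int \<Rightarrow> 'v set" where
  "cycles C d p = lin_ker (C p) (C (p - 1)) (d p)"

definition boundaries :: "('k, 'v) graded \<Rightarrow> (int \<Rightarrow> 'v \<Rightarrow> 'v) \<Rightarrow> int \<Rightarrow> 'v set" where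
  "boundaries C d p = d (p + 1) ` carrier (C (p + 1))"

definition homology_vs :: "('k, 'v) graded \<Rightarrow> (int \<Rightarrow> 'v \<Rightarrow> 'v) \<Rightarrow> ('k, 'v set) graded" where
  "homology_vs C d p = quot_vs ((C p)\<lparr>carrier := cycles C d p\<rparr>) (boundaries C d p)"

text \<open>The class of \<open>z\<close> is sent to the class of \<open>f z\<close> in the homology of the target \<open>(C', d')\<close>.\<close>

definition homology_map ::
  "('k, 'w) graded \<Rightarrow> (int \<Rightarrow> 'w \<Rightarrow> 'w) \<Rightarrow> (int \<Rightarrow> 'v \<Rightarrow> 'w) \<Rightarrow> int \<Rightarrow> 'v set \<Rightarrow> 'w set" where
  "homology_map C' d' f p A = boundaries C' d' p <+>\<^bsub>C' p\<^esub> (f p ` A)"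


section \<open>\<open>A\<^sub>\<infinity>\<close>-coalgebras\<close>

definition ainf_coalgebra ::
  "('k::field, 'v) graded \<Rightarrow> (nat \<Rightarrow> int \<Rightarrow> 'v \<Rightarrow> ('k, 'v) tensor) \<Rightarrow> bool" where
  "ainf_coalgebra C \<Delta> \<longleftrightarrow>
     (\<forall>n\<ge>1. \<forall>p. \<Delta> n p \<in> module_hom class_ring (C p) (tensor_pow C n (p + int n - 2))) \<and>
     (\<forall>n\<ge>1. \<forall>p. \<forall>c \<in> carrier (C p).
        (\<Oplus>\<^bsub>tensor_alg C\<^esub>i\<in>{1..n}. \<Oplus>\<^bsub>tensor_alg C\<^esub>j\<in>{0..n - i}.
           ksign (int (i + j + i * j)) \<odot>\<^bsub>tensor_alg C\<^esub>
             one_op_one C (n - i - j) (int i - 2) (\<Delta> i) j (\<Delta> (n - i + 1) p c))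
        = \<zero>\<^bsub>tensor_alg C\<^esub>)"

definition ainf_minimal ::
  "('k::field, 'v) graded \<Rightarrow> (nat \<Rightarrow> int \<Rightarrow> 'v \<Rightarrow> ('k, 'v) tensor) \<Rightarrow> bool" where
  "ainf_minimal C \<Delta> \<longleftrightarrow> (\<forall>p. \<forall>c \<in> carrier (C p). \<Delta> 1 p c = \<zero>\<^bsub>tensor_alg C\<^esub>)"

definition desusp :: "('k, 'v) graded \<Rightarrow> ('k, 'v) graded" where
  "desusp C p = C (p + 1)"

text \<open>The \<open>n\<close>-th tensor power of the desuspension, which on vectors is the identity map
  lowering the degree tag by one.\<close>

definition desusp_pow :: "('k::field, 'v) graded \<Rightarrow> nat \<Rightarrow> ('k, 'v) tensor \<Rightarrow> ('k, 'v) tensor" where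
  "desusp_pow C n = tensor_map (desusp C) (replicate n (- 1, \<lambda>p. letter (desusp C) (p - 1)))"

text \<open>The part of degree \<open>q\<close> of the complete tensor algebra: sequences of tensors of degree \<open>q\<close>, the
  one of index \<open>n\<close> lying in the \<open>n\<close>-th tensor power; the value at index \<open>0\<close> is irrelevant.\<close>

definition complete_tensor :: "('k::field, 'v) graded \<Rightarrow> int \<Rightarrow> (nat \<Rightarrow> ('k, 'v) tensor) set" where
  "complete_tensor V q = {x. \<forall>n\<ge>1. x n \<in> carrier (tensor_pow V n q)}"

definition cobar_gen ::
  "('k::field, 'v) graded \<Rightarrow> (nat \<Rightarrow> int \<Rightarrow> 'v \<Rightarrow> ('k, 'v) tensor)
     \<Rightarrow> nat \<Rightarrow> int \<Rightarrow> 'v \<Rightarrow> ('k, 'v) tensor" where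
  "cobar_gen C \<Delta> n q v = (- 1) \<odot>\<^bsub>tensor_alg (desusp C)\<^esub> desusp_pow C n (\<Delta> n (q + 1) v)"

text \<open>The derivation of the complete tensor algebra of \<open>desusp C\<close> extending \<open>\<Sum>n. cobar_gen C \<Delta> n\<close>,
  given by its component of word length \<open>m\<close>.\<close>

definition cobar_diff ::
  "('k::field, 'v) graded \<Rightarrow> (nat \<Rightarrow> int \<Rightarrow> 'v \<Rightarrow> ('k, 'v) tensor)
     \<Rightarrow> (nat \<Rightarrow> ('k, 'v) tensor) \<Rightarrow> nat \<Rightarrow> ('k, 'v) tensor" where
  "cobar_diff C \<Delta> x m =
     (\<Oplus>\<^bsub>tensor_alg (desusp C)\<^esub>n\<in>{1..m}. \<Oplus>\<^bsub>tensor_alg (desusp C)\<^esub>j\<in>{0..<n}.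
        one_op_one (desusp C) (n - 1 - j) (- 1) (cobar_gen C \<Delta> (m - n + 1)) j (x n))"

text \<open>The algebra morphism of complete tensor algebras with
  \<open>s\<inverse>c \<mapsto> \<Sum>k. (s\<inverse>)\<^sup>\<otimes>\<^sup>k (F k c)\<close>, given by its component of word length \<open>m\<close>.\<close>

definition cobar_map ::
  "('k::field, 'w) graded \<Rightarrow> (nat \<Rightarrow> int \<Rightarrow> 'v \<Rightarrow> ('k, 'w) tensor)
     \<Rightarrow> (nat \<Rightarrow> ('k, 'v) tensor) \<Rightarrow> nat \<Rightarrow> ('k, 'w) tensor" where
  "cobar_map C' F x m =
     (\<Oplus>\<^bsub>tensor_alg (desusp C')\<^esub>n\<in>{1..m}.
        \<Oplus>\<^bsub>tensor_alg (desusp C')\<^esub>ks\<in>{ks. length ks = n \<and> 0 \<notin> set ks \<and> sum_list ks = m}.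
          tensor_map (desusp C')
            (map (\<lambda>k. (0, \<lambda>q v. desusp_pow C' k (F k (q + 1) v))) ks) (x n))"

definition ainf_morphism ::
  "('k::field, 'v) graded \<Rightarrow> (nat \<Rightarrow> int \<Rightarrow> 'v \<Rightarrow> ('k, 'v) tensor)
     \<Rightarrow> ('k, 'w) graded \<Rightarrow> (nat \<Rightarrow> int \<Rightarrow> 'w \<Rightarrow> ('k, 'w) tensor)
     \<Rightarrow> (nat \<Rightarrow> int \<Rightarrow> 'v \<Rightarrow> ('k, 'w) tensor) \<Rightarrow> bool" where
  "ainf_morphism C \<Delta> C' \<Delta>' F \<longleftrightarrow>
     (\<forall>k\<ge>1. \<forall>p. F k p \<in> module_hom class_ring (C p) (tensor_pow C' k (p + int k - 1))) \<and>
     (\<forall>q. \<forall>x \<in> complete_tensor (desusp C) q. \<forall>m\<ge>1.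
        cobar_map C' F (cobar_diff C \<Delta> x) m = cobar_diff C' \<Delta>' (cobar_map C' F x) m)"

definition ainf_diff ::
  "('k::field, 'v) graded \<Rightarrow> (nat \<Rightarrow> int \<Rightarrow> 'v \<Rightarrow> ('k, 'v) tensor) \<Rightarrow> int \<Rightarrow> 'v \<Rightarrow> 'v" where
  "ainf_diff C \<Delta> p c = unletter C (p - 1) (\<Delta> 1 p c)"

definition ainf_quasi_iso ::
  "('k::field, 'v) graded \<Rightarrow> (nat \<Rightarrow> int \<Rightarrow> 'v \<Rightarrow> ('k, 'v) tensor)
     \<Rightarrow> ('k, 'w) graded \<Rightarrow> (nat \<Rightarrow> int \<Rightarrow> 'w \<Rightarrow> ('k, 'w) tensor)
     \<Rightarrow> (nat \<Rightarrow> int \<Rightarrow> 'v \<Rightarrow> ('k, 'w) tensor) \<Rightarrow> bool" where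
  "ainf_quasi_iso C \<Delta> C' \<Delta>' F \<longleftrightarrow>
     ainf_morphism C \<Delta> C' \<Delta>' F \<and>
     (\<forall>p. bij_betw
        (homology_map C' (ainf_diff C' \<Delta>') (\<lambda>q c. unletter C' q (F 1 q c)) p)
        (carrier (homology_vs C (ainf_diff C \<Delta>) p))
        (carrier (homology_vs C' (ainf_diff C' \<Delta>') p)))"

text \<open>Over a field \<open>A\<^sub>\<infinity>\<close>-quasi-isomorphisms have quasi-inverses, so either direction is allowed.\<close>

definition ainf_quasi_isomorphic ::
  "('k::field, 'v) graded \<Rightarrow> (nat \<Rightarrow> int \<Rightarrow> 'v \<Rightarrow> ('k, 'v) tensor)
     \<Rightarrow> ('k, 'w) graded \<Rightarrow> (nat \<Rightarrow> int \<Rightarrow> 'w \<Rightarrow> ('k, 'w) tensor) \<Rightarrow> bool" where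
  "ainf_quasi_isomorphic C \<Delta> C' \<Delta>' \<longleftrightarrow>
     (\<exists>F. ainf_quasi_iso C \<Delta> C' \<Delta>' F) \<or> (\<exists>F. ainf_quasi_iso C' \<Delta>' C \<Delta> F)"


section \<open>Singular chains and homology with field coefficients\<close>

type_synonym ('k, 'a) sing = "((nat \<Rightarrow> real) \<Rightarrow> 'a) \<Rightarrow>\<^sub>0 'k"

definition sing_chains :: "'a topology \<Rightarrow> ('k::field, ('k, 'a) sing) graded" where
  "sing_chains X p = free_vs {\<sigma>. 0 \<le> p \<and> singular_simplex (nat p) X \<sigma>}"

definition sing_bd :: "int \<Rightarrow> ('k::field, 'a) sing \<Rightarrow> ('k, 'a) sing" where
  "sing_bd p c = (if p \<le> 0 then 0
     else lin_ext (\<lambda>\<sigma>. \<Sum>k\<le>nat p. Poly_Mapping.single (singular_face (nat p) k \<sigma>) ((- 1) ^ k)) c)"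

definition sing_homology :: "'a topology \<Rightarrow> ('k::field, ('k, 'a) sing set) graded" where
  "sing_homology X = homology_vs (sing_chains X) sing_bd"

text \<open>The map induced in homology by a map \<open>g\<close> into the space \<open>Y\<close>.\<close>

definition sing_homology_map ::
  "'b topology \<Rightarrow> ('a \<Rightarrow> 'b) \<Rightarrow> int \<Rightarrow> ('k::field, 'a) sing set \<Rightarrow> ('k, 'b) sing set" where
  "sing_homology_map Y g = homology_map (sing_chains Y) sing_bd
     (\<lambda>p. lin_ext (\<lambda>\<sigma>. Poly_Mapping.single (simplex_map (nat p) g \<sigma>) 1))"

text \<open>Front and back faces of a \<open>p\<close>-simplex, spanned by the vertices \<open>0, \<dots>, k\<close> and \<open>k, \<dots>, p\<close>.\<close>

definition front_face :: "nat \<Rightarrow> ((nat \<Rightarrow> real) \<Rightarrow> 'a) \<Rightarrow> (nat \<Rightarrow> real) \<Rightarrow> 'a" where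
  "front_face k \<sigma> = restrict \<sigma> (standard_simplex k)"

definition back_face :: "nat \<Rightarrow> nat \<Rightarrow> ((nat \<Rightarrow> real) \<Rightarrow> 'a) \<Rightarrow> (nat \<Rightarrow> real) \<Rightarrow> 'a" where
  "back_face p k \<sigma> =
     restrict (\<lambda>x. \<sigma> (\<lambda>i. if i < k then 0 else x (i - k))) (standard_simplex (p - k))"

definition alexander_whitney ::
  "'a topology \<Rightarrow> int \<Rightarrow> ('k::field, 'a) sing \<Rightarrow> ('k, ('k, 'a) sing) tensor" where
  "alexander_whitney X p c = tensor_class (sing_chains X)
     (lin_ext (\<lambda>\<sigma>. \<Sum>k\<le>nat p. Poly_Mapping.single
        [(int k, Poly_Mapping.single (front_face k \<sigma>) 1),
         (p - int k, Poly_Mapping.single (back_face (nat p) k \<sigma>) 1)] 1) c)"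

definition sing_bd2 ::
  "'a topology \<Rightarrow> ('k::field, ('k, 'a) sing) tensor \<Rightarrow> ('k, ('k, 'a) sing) tensor" where
  "sing_bd2 X A =
     (let C = sing_chains X; d = (\<lambda>p c. letter C (p - 1) (sing_bd p c))
      in one_op_one C 0 (- 1) d 1 A \<oplus>\<^bsub>tensor_alg C\<^esub> one_op_one C 1 (- 1) d 0 A)"

text \<open>A coassociative approximation to the diagonal of \<open>X\<close>: a coassociative chain map
  from the singular chains of \<open>X\<close> to their tensor square that is chain homotopic to the
  Alexander--Whitney comultiplication. The latter is the diagonal map of \<open>X\<close> followed by the
  Eilenberg--Zilber equivalence.\<close>

definition diagonal_approximation ::
  "'a topology \<Rightarrow> (int \<Rightarrow> ('k::field, 'a) sing \<Rightarrow> ('k, ('k, 'a) sing) tensor) \<Rightarrow> bool" where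
  "diagonal_approximation X D \<longleftrightarrow>
     (let C = sing_chains X in
      (\<forall>p. D p \<in> module_hom class_ring (C p) (tensor_pow C 2 p)) \<and>
      (\<forall>p. \<forall>c \<in> carrier (C p). sing_bd2 X (D p c) = D (p - 1) (sing_bd p c)) \<and>
      (\<forall>p. \<forall>c \<in> carrier (C p). one_op_one C 0 0 D 1 (D p c) = one_op_one C 1 0 D 0 (D p c)) \<and>
      (\<exists>h. (\<forall>p. h p \<in> module_hom class_ring (C p) (tensor_pow C 2 (p + 1))) \<and>
           (\<forall>p. \<forall>c \<in> carrier (C p).
              D p c = alexander_whitney X p c \<oplus>\<^bsub>tensor_alg C\<^esub>
                (sing_bd2 X (h p c) \<oplus>\<^bsub>tensor_alg C\<^esub> h (p - 1) (sing_bd p c)))))"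

definition sing_ainf ::
  "'a topology \<Rightarrow> (int \<Rightarrow> ('k::field, 'a) sing \<Rightarrow> ('k, ('k, 'a) sing) tensor)
     \<Rightarrow> nat \<Rightarrow> int \<Rightarrow> ('k, 'a) sing \<Rightarrow> ('k, ('k, 'a) sing) tensor" where
  "sing_ainf X D n p c =
     (if n = 1 then letter (sing_chains X) (p - 1) (sing_bd p c)
      else if n = 2 then D p c
      else \<zero>\<^bsub>tensor_alg (sing_chains X)\<^esub>)"

definition transferred_ainf ::
  "'a topology \<Rightarrow> (nat \<Rightarrow> int \<Rightarrow> ('k::field, 'a) sing set \<Rightarrow> ('k, ('k, 'a) sing set) tensor)
     \<Rightarrow> bool" where
  "transferred_ainf X \<Delta> \<longleftrightarrow>
     ainf_coalgebra (sing_homology X) \<Delta> \<and> ainf_minimal (sing_homology X) \<Delta> \<and>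
     (\<exists>D. diagonal_approximation X D \<and>
        ainf_quasi_isomorphic (sing_chains X) (sing_ainf X D) (sing_homology X) \<Delta>)"


section \<open>\<open>\<Delta>\<^sub>n\<close>-persistent groups and barcodes\<close>

text \<open>\<open>g i\<close> is the map from \<open>K i\<close> to \<open>K (i + 1)\<close>, so that \<open>fold g [i..<j]\<close> is the composite from
  \<open>K i\<close> to \<open>K j\<close>.\<close>

definition persistence_map ::
  "(nat \<Rightarrow> 'a topology) \<Rightarrow> (nat \<Rightarrow> 'a \<Rightarrow> 'a) \<Rightarrow> nat \<Rightarrow> nat \<Rightarrow> nat
     \<Rightarrow> ('k::field, 'a) sing set \<Rightarrow> ('k, 'a) sing set" where
  "persistence_map K g p i j = sing_homology_map (K j) (fold g [i..<j]) (int p)"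

definition Delta_ker ::
  "(nat \<Rightarrow> 'a topology)
     \<Rightarrow> (nat \<Rightarrow> nat \<Rightarrow> int \<Rightarrow> ('k::field, 'a) sing set \<Rightarrow> ('k, ('k, 'a) sing set) tensor)
     \<Rightarrow> nat \<Rightarrow> nat \<Rightarrow> nat \<Rightarrow> ('k, 'a) sing set set" where
  "Delta_ker K \<Delta> n p i =
     lin_ker (sing_homology (K i) (int p)) (tensor_alg (sing_homology (K i))) (\<Delta> i n (int p))"

definition Delta_persistent ::
  "(nat \<Rightarrow> 'a topology) \<Rightarrow> (nat \<Rightarrow> 'a \<Rightarrow> 'a)
     \<Rightarrow> (nat \<Rightarrow> nat \<Rightarrow> int \<Rightarrow> ('k::field, 'a) sing set \<Rightarrow> ('k, ('k, 'a) sing set) tensor)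
     \<Rightarrow> nat \<Rightarrow> nat \<Rightarrow> nat \<Rightarrow> nat \<Rightarrow> ('k, 'a) sing set set" where
  "Delta_persistent K g \<Delta> n p i j = persistence_map K g p i j `
     (\<Inter>k\<in>{i..j}. lin_ker (sing_homology (K i) (int p)) (tensor_alg (sing_homology (K k)))
        (\<Delta> k n (int p) \<circ> persistence_map K g p i k))"

definition subspace_dim :: "('k::field, 'v) module \<Rightarrow> 'v set \<Rightarrow> nat" where
  "subspace_dim V S = vectorspace.dim class_ring (V\<lparr>carrier := S\<rparr>)"

definition barcode_intervals :: "nat \<Rightarrow> real set set" where
  "barcode_intervals N = {{real i..<real j} | i j. i < j \<and> j \<le> N} \<union> {{real i..} | i. i \<le> N}"

definition is_Delta_barcode ::
  "nat \<Rightarrow> (nat \<Rightarrow> 'a topology) \<Rightarrow> (nat \<Rightarrow> 'a \<Rightarrow> 'a)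
     \<Rightarrow> (nat \<Rightarrow> nat \<Rightarrow> int \<Rightarrow> ('k::field, 'a) sing set \<Rightarrow> ('k, ('k, 'a) sing set) tensor)
     \<Rightarrow> nat \<Rightarrow> nat \<Rightarrow> real set multiset \<Rightarrow> bool" where
  "is_Delta_barcode N K g \<Delta> n p M \<longleftrightarrow>
     set_mset M \<subseteq> barcode_intervals N \<and>
     (\<forall>i j. i \<le> j \<and> j \<le> N \<longrightarrow>
        subspace_dim (sing_homology (K j) (int p)) (Delta_persistent K g \<Delta> n p i j)
        = size {#I \<in># M. {real i..real j} \<subseteq> I#})"

end

theory Submission
  imports Defs "Jordan_Normal_Form.DL_Rank"
begin

text \<open>By hypothesis the kernels \<open>U i = Ker \<Delta>\<^sup>i\<close> form a persistence module under the maps \<open>F i j\<close> induced in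
  homology, so the \<open>\<Delta>\<^sub>n\<close>-persistent group is \<open>F i j ` U i\<close>; let \<open>r i j\<close> be its dimension. The number
  of bars containing \<open>[i, j]\<close> is a sum of multiplicities over a rectangle of end points, so these
  are recovered by inclusion-exclusion: \<open>[i, j)\<close> must have multiplicity
  \<open>r i (j - 1) - r i j - r (i - 1) (j - 1) + r (i - 1) j\<close>. This is nonnegative, as by rank-nullity it
  compares the kernels of \<open>F (j - 1) j\<close> on two nested subspaces.\<close>

section \<open>Free, quotient and tensor spaces\<close>

text \<open>Closure under negation comes from scaling by -1. This makes the coset calculus of
  abelian subgroups available for subspaces.\<close>

lemma (in module) submodule_abelian_subgroup:
  assumes "submodule R N M"
  shows "abelian_subgroup N M"
proof -
  interpret N: submodule R N M by fact
  have inv: "\<ominus>\<^bsub>M\<^esub> x \<in> N" if "x \<in> N" for x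
  proof -
    have "(\<ominus>\<^bsub>R\<^esub> \<one>\<^bsub>R\<^esub>) \<odot>\<^bsub>M\<^esub> x \<in> N" using that by (intro N.smult_closed) auto
    moreover have "x \<in> carrier M" using that N.subset by blast
    ultimately show ?thesis by (simp add: smult_l_minus)
  qed
  have "additive_subgroup N M"
    using N.subset N.zero_closed inv empty_iff
    by (intro additive_subgroup.intro M.add.subgroupI) (force simp flip: a_inv_def)+
  then show ?thesis by (intro abelian_subgroupI3) (auto intro: M.abelian_group_axioms)
qed

lemma mem_set_add: "z \<in> A <+>\<^bsub>M\<^esub> B \<longleftrightarrow> (\<exists>a\<in>A. \<exists>b\<in>B. z = a \<oplus>\<^bsub>M\<^esub> b)"
  by (auto simp: set_add_def')

lemma mem_a_r_coset: "z \<in> N +>\<^bsub>M\<^esub> x \<longleftrightarrow> (\<exists>n\<in>N. z = n \<oplus>\<^bsub>M\<^esub> x)"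
  by (auto simp: a_r_coset_def')

text \<open>Replacing \<open>x\<close> by another representative \<open>n \<oplus> x\<close> changes
  the image by \<open>f n\<close>, which \<open>N'\<close> absorbs. Scaling in
  \<open>quot_vs\<close> and \<open>homology_map\<close> are both defined as such a sum of a
  subgroup and the image of a coset, so this reduces them to representatives.\<close>

lemma set_add_image_coset:
  assumes "abelian_subgroup N V" "abelian_subgroup N' W"
    and f: "f \<in> carrier V \<rightarrow> carrier W"
    and add: "\<And>x y. x \<in> carrier V \<Longrightarrow> y \<in> carrier V \<Longrightarrow> f (x \<oplus>\<^bsub>V\<^esub> y) = f x \<oplus>\<^bsub>W\<^esub> f y"
    and N: "f ` N \<subseteq> N'" and x: "x \<in> carrier V"
  shows "N' <+>\<^bsub>W\<^esub> f ` (N +>\<^bsub>V\<^esub> x) = N' +>\<^bsub>W\<^esub> f x"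
proof -
  interpret V: abelian_subgroup N V by fact
  interpret W: abelian_subgroup N' W by fact
  have "z \<in> N' +>\<^bsub>W\<^esub> f x" if "m \<in> N'" "n \<in> N" "z = m \<oplus>\<^bsub>W\<^esub> f (n \<oplus>\<^bsub>V\<^esub> x)" for z m n
  proof -
    have "n \<in> carrier V" "f n \<in> N'" using that N V.a_subset by auto
    moreover have "z = (m \<oplus>\<^bsub>W\<^esub> f n) \<oplus>\<^bsub>W\<^esub> f x"
      using that calculation W.a_subset f x by (simp add: add W.a_assoc Pi_iff subset_iff)
    ultimately show ?thesis using that W.a_closed by (auto simp: mem_a_r_coset)
  qed
  moreover have "z \<in> N' <+>\<^bsub>W\<^esub> f ` (N +>\<^bsub>V\<^esub> x)" if "m \<in> N'" "z = m \<oplus>\<^bsub>W\<^esub> f x" for z m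
  proof -
    have "x \<in> N +>\<^bsub>V\<^esub> x" using x by (rule V.a_rcos_self)
    then show ?thesis using that by (auto simp: mem_set_add)
  qed
  ultimately show ?thesis by (fastforce simp: mem_set_add mem_a_r_coset)
qed

lemma carrier_quot_vs: "carrier (quot_vs V N) = (\<lambda>x. N +>\<^bsub>V\<^esub> x) ` carrier V"
  by (auto simp: quot_vs_def A_RCOSETS_def')

context vectorspace
begin

lemma add_quot_vs:
  assumes "submodule K N V" "x \<in> carrier V" "y \<in> carrier V"
  shows "(N +>\<^bsub>V\<^esub> x) \<oplus>\<^bsub>quot_vs V N\<^esub> (N +>\<^bsub>V\<^esub> y) = N +>\<^bsub>V\<^esub> (x \<oplus>\<^bsub>V\<^esub> y)"
  using assms abelian_subgroup.a_rcos_sum[OF submodule_abelian_subgroup] by (simp add: quot_vs_def)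

lemma smult_quot_vs:
  assumes N: "submodule K N V" and "c \<in> carrier K" "x \<in> carrier V"
  shows "c \<odot>\<^bsub>quot_vs V N\<^esub> (N +>\<^bsub>V\<^esub> x) = N +>\<^bsub>V\<^esub> (c \<odot>\<^bsub>V\<^esub> x)"
proof -
  \<comment> \<open>Scaling by \<open>c\<close> plays the role of the additive map in the coset
    lemma, with \<open>N\<close> as both subgroups.\<close>
  have "smult V c ` N \<subseteq> N" using submodule.smult_closed[OF N assms(2)] by auto
  then show ?thesis
    using assms submodule_abelian_subgroup[OF N]
    by (simp add: quot_vs_def smult_r_distr Pi_iff set_add_image_coset)
qed

lemma zero_quot_vs:
  assumes "submodule K N V"
  shows "\<zero>\<^bsub>quot_vs V N\<^esub> = N +>\<^bsub>V\<^esub> \<zero>\<^bsub>V\<^esub>"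
  using assms submodule.subset[OF assms]
  by (simp add: quot_vs_def)

lemma quot_vs_vectorspace:
  assumes N: "submodule K N V"
  shows "vectorspace K (quot_vs V N)"
proof -
  note s = add_quot_vs[OF N] smult_quot_vs[OF N] zero_quot_vs[OF N]
  have inv: "(N +>\<^bsub>V\<^esub> \<ominus>\<^bsub>V\<^esub> x) \<oplus>\<^bsub>quot_vs V N\<^esub> (N +>\<^bsub>V\<^esub> x) = \<zero>\<^bsub>quot_vs V N\<^esub>" if "x \<in> carrier V" for x
    using that by (simp add: s M.l_neg)
  have "abelian_group (quot_vs V N)"
  proof (rule abelian_groupI)
    fix A assume "A \<in> carrier (quot_vs V N)"
    then show "\<exists>B\<in>carrier (quot_vs V N). B \<oplus>\<^bsub>quot_vs V N\<^esub> A = \<zero>\<^bsub>quot_vs V N\<^esub>"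
      using inv by (auto simp: carrier_quot_vs)
  qed (auto simp: carrier_quot_vs s(1,3) M.a_ac)
  then have "module K (quot_vs V N)"
    by (intro moduleI R.cring_axioms)
      (auto simp: carrier_quot_vs s smult_l_distr smult_r_distr smult_assoc1)
  then show ?thesis by (intro vectorspace.intro field_axioms)
qed

end

section \<open>Free vector spaces and the tensor algebra\<close>

lemma pm_scale_lookup [simp]: "Poly_Mapping.lookup (pm_scale c x) k = c * Poly_Mapping.lookup x k"
  by (simp add: pm_scale_def Poly_Mapping.map.rep_eq when_def)

lemma keys_pm_scale: "Poly_Mapping.keys (pm_scale c x) \<subseteq> Poly_Mapping.keys x"
  by (auto simp: in_keys_iff)

lemma pm_scale_simps:
  "pm_scale 0 x = 0" "pm_scale 1 x = x" "pm_scale c 0 = 0"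
  "pm_scale c (x + y) = pm_scale c x + pm_scale c y"
  "pm_scale (c + d) x = pm_scale c x + pm_scale d x"
  "pm_scale c (pm_scale d x) = pm_scale (c * d) x"
  "pm_scale c (Poly_Mapping.single s d) = Poly_Mapping.single s (c * d)"
  by (auto intro!: poly_mapping_eqI simp: lookup_add algebra_simps lookup_single when_def)

lemma pm_scale_sum: "pm_scale c (sum f A) = (\<Sum>a\<in>A. pm_scale c (f a))"
  by (induction A rule: infinite_finite_induct) (simp_all add: pm_scale_simps)

lemma free_vs_simps [simp]:
  "carrier (free_vs S) = {x. Poly_Mapping.keys x \<subseteq> S}" "\<zero>\<^bsub>free_vs S\<^esub> = 0"
  "x \<oplus>\<^bsub>free_vs S\<^esub> y = x + y" "c \<odot>\<^bsub>free_vs S\<^esub> x = pm_scale c x"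
  by (simp_all add: free_vs_def)

text \<open>Phrased by the four fields that matter for a vector space, because
  \<open>free_vs\<close> and \<open>word_alg\<close> differ in their multiplicative fields and both
  must be covered.\<close>

lemma vectorspace_if_free:
  fixes V :: "('k::field, 's \<Rightarrow>\<^sub>0 'k, 'b) module_scheme"
  assumes s: "carrier V = {x. Poly_Mapping.keys x \<subseteq> S}" "\<zero>\<^bsub>V\<^esub> = 0" "add V = (+)" "smult V = pm_scale"
  shows "vectorspace class_ring V"
proof -
  have "abelian_group V"
  proof (rule abelian_groupI)
    fix x assume "x \<in> carrier V"
    then show "\<exists>y\<in>carrier V. y \<oplus>\<^bsub>V\<^esub> x = \<zero>\<^bsub>V\<^esub>"
      by (intro bexI[of _ "- x"]) (auto simp: s)
  qed (use keys_add in \<open>fastforce simp: s add_ac\<close>)+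
  then have "module class_ring V"
    by (intro moduleI class_cring.cring_axioms)
      (use keys_pm_scale in \<open>fastforce simp: s pm_scale_simps\<close>)+
  then show ?thesis by (intro vectorspace.intro class_field)
qed

lemma free_vs_vectorspace: "vectorspace class_ring (free_vs S)"
  by (rule vectorspace_if_free[of _ S]) (simp_all add: free_vs_def fun_eq_iff)

lemma word_alg_simps [simp]:
  "carrier (word_alg C) = {x. Poly_Mapping.keys x \<subseteq> words C}" "\<zero>\<^bsub>word_alg C\<^esub> = 0"
  "x \<oplus>\<^bsub>word_alg C\<^esub> y = x + y" "c \<odot>\<^bsub>word_alg C\<^esub> x = pm_scale c x"
  by (simp_all add: word_alg_def free_vs_def)

lemma word_alg_vectorspace: "vectorspace class_ring (word_alg C)"
  by (rule vectorspace_if_free[of _ "words C"]) (simp_all add: fun_eq_iff)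

text \<open>The generating relations are combinations of words over \<open>C\<close>, so their span
  is a submodule of the word algebra and the quotient is a vector space. It serves as the target of
  the operations \<open>\<Delta> n p\<close> when their kernels are studied.\<close>

lemma tensor_alg_vectorspace:
  assumes "\<And>q. vectorspace class_ring (C q)"
  shows "vectorspace class_ring (tensor_alg C)"
proof -
  interpret W: vectorspace class_ring "word_alg C" by (rule word_alg_vectorspace)
  have m: "module class_ring (C q)" for q using assms[of q] by (simp add: vectorspace_def)
  have c: "v \<oplus>\<^bsub>C p\<^esub> v' \<in> carrier (C p)" "c \<odot>\<^bsub>C p\<^esub> v \<in> carrier (C p)"
    if "v \<in> carrier (C p)" "v' \<in> carrier (C p)" for c v v' p
    using that abelian_groupE(1)[OF module.axioms(2)[OF m]] module.smult_closed[OF m] by auto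
  have "submodule class_ring (tensor_rels C) (word_alg C)"
    unfolding tensor_rels_def
    by (rule W.span_is_submodule) (auto dest!: keys_diff[THEN subsetD] simp: c words_def split: if_splits)
  then show ?thesis
    unfolding tensor_alg_def by (rule W.quot_vs_vectorspace)
qed

section \<open>Barcodes from rank functions\<close>

text \<open>The index \<open>(i, N + 1)\<close> stands for the unbounded interval starting at \<open>i\<close>.\<close>

definition bar :: "nat \<Rightarrow> nat \<times> nat \<Rightarrow> real set" where
  "bar N = (\<lambda>(i, j). if j \<le> N then {real i..<real j} else {real i..})"

definition bar_index :: "nat \<Rightarrow> (nat \<times> nat) set" where
  "bar_index N = {(i, j). i < j \<and> j \<le> Suc N}"

lemma finite_bar_index [simp]: "finite (bar_index N)"
  by (rule finite_subset[of _ "{..Suc N} \<times> {..Suc N}"]) (auto simp: bar_index_def)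

lemma barcode_intervals_eq: "barcode_intervals N = bar N ` bar_index N"
proof (intro equalityI subsetI)
  fix I assume "I \<in> barcode_intervals N"
  then consider i j where "I = {real i..<real j}" "i < j" "j \<le> N" | i where "I = {real i..}" "i \<le> N"
    by (auto simp: barcode_intervals_def)
  then show "I \<in> bar N ` bar_index N"
  proof cases
    case 1
    then show ?thesis by (intro image_eqI[of _ _ "(i, j)"]) (auto simp: bar_def bar_index_def)
  next
    case 2
    then show ?thesis by (intro image_eqI[of _ _ "(i, Suc N)"]) (auto simp: bar_def bar_index_def)
  qed
next
  fix I assume "I \<in> bar N ` bar_index N"
  then obtain i j where ij: "i < j" "j \<le> Suc N" and I: "I = bar N (i, j)"
    by (auto simp: bar_index_def)
  then show "I \<in> barcode_intervals N"
    unfolding barcode_intervals_def bar_def by (cases "j \<le> N") force+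
qed

text \<open>A bounded bar is nonempty because \<open>i < j\<close>, so it determines its end points,
  and it is never a ray. Multiplicities of bars can therefore be handled as functions on index
  pairs.\<close>

lemma inj_on_bar: "inj_on (bar N) (bar_index N)"
proof (rule inj_onI; clarify)
  fix i j i' j' assume *: "(i, j) \<in> bar_index N" "(i', j') \<in> bar_index N" "bar N (i, j) = bar N (i', j')"
  have ne: "{a..<b} \<noteq> {c..}" for a b c :: real
  proof
    assume eq: "{a..<b} = {c..}"
    \<comment> \<open>This point of the ray is at least \<open>b\<close>, hence outside
      \<open>{a..<b}\<close>.\<close>
    have "max b c \<in> {c..}" by simp
    then show False unfolding eq[symmetric] by simp
  qed
  from * show "i = i' \<and> j = j'"
    by (auto simp: bar_index_def bar_def atLeastLessThan_eq_iff ne ne[symmetric] split: if_splits)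
qed

text \<open>Bars are convex, so only the two end points matter. For a ray the condition
  \<open>b < j\<close> reads \<open>b < N + 1\<close>, which \<open>b \<le> N\<close> grants; one
  criterion thus covers both kinds of bars.\<close>

lemma Icc_subset_bar_iff:
  assumes "a \<le> b" "b \<le> N" "(i, j) \<in> bar_index N"
  shows "{real a..real b} \<subseteq> bar N (i, j) \<longleftrightarrow> i \<le> a \<and> b < j"
proof
  assume "{real a..real b} \<subseteq> bar N (i, j)"
  then have "real a \<in> bar N (i, j)" "real b \<in> bar N (i, j)" using assms by auto
  then show "i \<le> a \<and> b < j" using assms by (auto simp: bar_def bar_index_def split: if_splits)
qed (use assms in \<open>auto simp: bar_def bar_index_def\<close>)

text \<open>By the containment criterion, the index pairs of the bars counted here form the
  rectangle \<open>i \<le> a\<close>, \<open>b < j \<le> N + 1\<close>, and distinct pairs give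
  distinct bars.\<close>

lemma size_filter_barcode:
  assumes M: "set_mset M \<subseteq> barcode_intervals N" and ab: "a \<le> b" "b \<le> N"
  shows "size {#I \<in># M. {real a..real b} \<subseteq> I#}
    = (\<Sum>i<Suc a. \<Sum>j = Suc b..Suc N. count M (bar N (i, j)))"
proof -
  let ?P = "\<lambda>I. {real a..real b} \<subseteq> I" and ?R = "{..<Suc a} \<times> {Suc b..Suc N}"
  have R: "?R \<subseteq> bar_index N" using ab by (auto simp: bar_index_def)
  have "size (filter_mset ?P M) = (\<Sum>I\<in>set_mset (filter_mset ?P M). count M I)"
    by (simp add: size_multiset_overloaded_eq)
  also have "\<dots> = (\<Sum>I\<in>bar N ` ?R. count M I)"
  \<comment> \<open>Every bar of the rectangle contains the interval, so one outside the filtered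
    support does not occur in \<open>M\<close> and contributes zero.\<close>
  proof (rule sum.mono_neutral_left)
    show "set_mset (filter_mset ?P M) \<subseteq> bar N ` ?R"
    proof
      fix I assume I: "I \<in> set_mset (filter_mset ?P M)"
      then obtain i j where ij: "(i, j) \<in> bar_index N" "I = bar N (i, j)"
        using M by (auto simp: barcode_intervals_eq)
      then have "(i, j) \<in> ?R"
        using I iffD1[OF Icc_subset_bar_iff[OF ab ij(1)]] unfolding bar_index_def ij(2) by simp
      then show "I \<in> bar N ` ?R" using ij by blast
    qed
    show "\<forall>I\<in>bar N ` ?R - set_mset (filter_mset ?P M). count M I = 0"
    proof
      fix I assume I: "I \<in> bar N ` ?R - set_mset (filter_mset ?P M)"
      then obtain i j where ij: "(i, j) \<in> ?R" "I = bar N (i, j)" by blast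
      moreover have "(i, j) \<in> bar_index N" using R ij by blast
      ultimately have "?P I"
        using ij iffD2[OF Icc_subset_bar_iff[OF ab, of i j]] by simp
      then show "count M I = 0" using I by (auto simp: not_in_iff)
    qed
  qed simp
  also have "\<dots> = (\<Sum>x\<in>?R. count M (bar N x))"
    by (subst sum.reindex) (auto intro: inj_on_subset[OF inj_on_bar R])
  also have "\<dots> = (\<Sum>i<Suc a. \<Sum>j = Suc b..Suc N. count M (bar N (i, j)))"
    unfolding sum.cartesian_product by (rule sum.cong) auto
  finally show ?thesis .
qed

section \<open>Sums over rectangles of indices and their inversion\<close>

text \<open>The rectangles differ by the row \<open>a\<close> and the column \<open>b\<close>, which
  meet in the corner \<open>m a b\<close>. No subtraction occurs, so the identity is available over
  \<open>nat\<close>.\<close>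

lemma rectangle_sum_inclusion_exclusion:
  fixes m :: "nat \<Rightarrow> nat \<Rightarrow> 'a::comm_monoid_add"
  assumes "b \<le> n"
  shows "(\<Sum>i<Suc a. \<Sum>j=b..n. m i j) + (\<Sum>i<a. \<Sum>j=Suc b..n. m i j)
    = (\<Sum>i<Suc a. \<Sum>j=Suc b..n. m i j) + (\<Sum>i<a. \<Sum>j=b..n. m i j) + m a b"
  using assms by (simp add: sum.atLeast_Suc_atMost[of b n] add_ac)

text \<open>The entry \<open>m a b\<close> is isolated by four rectangles with adjacent corners,
  whose sums agree for \<open>m\<close> and \<open>m'\<close>.\<close>

lemma rectangle_sum_determines:
  fixes m m' :: "nat \<Rightarrow> nat \<Rightarrow> nat"
  assumes eq: "\<And>a b. a \<le> b \<Longrightarrow> b \<le> N \<Longrightarrow>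
      (\<Sum>i<Suc a. \<Sum>j = Suc b..Suc N. m i j) = (\<Sum>i<Suc a. \<Sum>j = Suc b..Suc N. m' i j)"
    and "a < b" "b \<le> Suc N"
  shows "m a b = m' a b"
proof -
  \<comment> \<open>Shifted by one, the hypothesis covers the rectangles with \<open>0 < a\<close>
    and \<open>b \<le> N + 1\<close>; the remaining ones are empty, so both sums vanish.\<close>
  have eq': "(\<Sum>i<a. \<Sum>j=b..Suc N. m i j) = (\<Sum>i<a. \<Sum>j=b..Suc N. m' i j)" if le: "a \<le> b" for a b
  proof (cases "a = 0 \<or> b > Suc N")
    case False
    then obtain a' b' where "a = Suc a'" "b = Suc b'" using le False by (cases a; cases b) auto
    then show ?thesis using False le eq[of a' b'] by (simp del: sum.cl_ivl_Suc sum.lessThan_Suc)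
  qed auto
  show ?thesis
    using rectangle_sum_inclusion_exclusion[OF \<open>b \<le> Suc N\<close>, of m a]
      rectangle_sum_inclusion_exclusion[OF \<open>b \<le> Suc N\<close>, of m' a] eq'[of "Suc a" b]
      eq'[of a "Suc b"] eq'[of a b] eq'[of "Suc a" "Suc b"] \<open>a < b\<close> by linarith
qed

text \<open>The solution is the mixed second difference of \<open>r\<close>, extended by zero. The
  three hypotheses make this difference nonnegative on the first row, on the last column and
  elsewhere.\<close>

lemma rectangle_sum_exists:
  fixes r :: "nat \<Rightarrow> nat \<Rightarrow> nat"
  assumes first: "\<And>b. b < N \<Longrightarrow> r 0 (Suc b) \<le> r 0 b"
    and last: "\<And>a. a < N \<Longrightarrow> r a N \<le> r (Suc a) N"
    and step: "\<And>a b. a < b \<Longrightarrow> b < N \<Longrightarrow>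
      r (Suc a) (Suc b) + r a b \<le> r (Suc a) b + r a (Suc b)"
  shows "\<exists>m :: nat \<Rightarrow> nat \<Rightarrow> nat. \<forall>a b. a \<le> b \<longrightarrow> b \<le> N \<longrightarrow>
    (\<Sum>i<Suc a. \<Sum>j = Suc b..Suc N. m i j) = r a b"
proof -
  \<comment> \<open>\<open>\<rho>\<close> is \<open>r\<close> with both indices shifted by one, extended by zero to \<open>a = -1\<close> and \<open>b = N + 1\<close>.\<close>
  define \<rho> where "\<rho> a b = (if a = 0 \<or> Suc N < b then 0 else r (a - 1) (b - 1))" for a b
  \<comment> \<open>By the inequality \<open>le\<close> below, the subtraction is not truncated at
    index pairs with \<open>a < b \<le> N + 1\<close>.\<close>
  define m where "m a b = \<rho> (Suc a) b + \<rho> a (Suc b) - (\<rho> (Suc a) (Suc b) + \<rho> a b)" for a b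
  have le: "\<rho> (Suc a) (Suc b) + \<rho> a b \<le> \<rho> (Suc a) b + \<rho> a (Suc b)" if "a < b" "b \<le> Suc N" for a b
    using that first[of "b - 1"] last[of "a - 1"] step[of "a - 1" "b - 1"]
    by (cases a; cases b; cases "b = Suc N") (auto simp: \<rho>_def)
  have "a \<le> b \<Longrightarrow> (\<Sum>i<a. \<Sum>j=b..Suc N. m i j) = \<rho> a b" for a b
  \<comment> \<open>The measure drops when \<open>a\<close> decreases or \<open>b\<close> increases,
    so the other three rectangles of the inclusion-exclusion identity are already known. Empty
    rectangles, where \<open>\<rho>\<close> is zero, are the base.\<close>
  proof (induction "a + (Suc (Suc N) - b)" arbitrary: a b rule: less_induct)
    case less
    show ?case
    proof (cases "a = 0 \<or> Suc N < b")
      case False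
      then obtain a' where a: "a = Suc a'" and b: "b \<le> Suc N" by (cases a) auto
      have "m a' b + (\<rho> a (Suc b) + \<rho> a' b) = \<rho> a b + \<rho> a' (Suc b)"
        using le[of a' b] less.prems b by (simp add: a m_def)
      moreover have "(\<Sum>i<a'. \<Sum>j=b..Suc N. m i j) = \<rho> a' b"
        "(\<Sum>i<a'. \<Sum>j=Suc b..Suc N. m i j) = \<rho> a' (Suc b)"
        "(\<Sum>i<a. \<Sum>j=Suc b..Suc N. m i j) = \<rho> a (Suc b)"
        using less.prems b by (auto intro!: less.hyps simp: a simp del: sum.cl_ivl_Suc sum.lessThan_Suc)
      ultimately show ?thesis
        using rectangle_sum_inclusion_exclusion[OF b, of m a'] unfolding a[symmetric] by linarith
    qed (auto simp: \<rho>_def)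
  qed
  then have "(\<Sum>i<Suc a. \<Sum>j = Suc b..Suc N. m i j) = \<rho> (Suc a) (Suc b)" if "a \<le> b" for a b
    using that by (metis Suc_le_mono)
  moreover have "\<rho> (Suc a) (Suc b) = r a b" if "b \<le> N" for a b
    using that by (simp add: \<rho>_def)
  ultimately show ?thesis by metis
qed

text \<open>Counting turns the claim about multisets into a linear system for multiplicities on
  index pairs: existence is its solvability over \<open>nat\<close>, uniqueness the fact that
  rectangle sums determine the entries.\<close>

theorem barcode_ex1:
  fixes r :: "nat \<Rightarrow> nat \<Rightarrow> nat"
  assumes "\<And>b. b < N \<Longrightarrow> r 0 (Suc b) \<le> r 0 b"
    and "\<And>a. a < N \<Longrightarrow> r a N \<le> r (Suc a) N"
    and "\<And>a b. a < b \<Longrightarrow> b < N \<Longrightarrow>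
      r (Suc a) (Suc b) + r a b \<le> r (Suc a) b + r a (Suc b)"
  shows "\<exists>!M. set_mset M \<subseteq> barcode_intervals N \<and>
    (\<forall>i j. i \<le> j \<and> j \<le> N \<longrightarrow> r i j = size {#I \<in># M. {real i..real j} \<subseteq> I#})"
    (is "\<exists>!M. ?P M")
proof -
  have "\<exists>m :: nat \<Rightarrow> nat \<Rightarrow> nat. \<forall>a b. a \<le> b \<longrightarrow> b \<le> N \<longrightarrow>
      (\<Sum>i<Suc a. \<Sum>j = Suc b..Suc N. m i j) = r a b"
    by (rule rectangle_sum_exists) (rule assms; assumption)+
  then obtain m :: "nat \<Rightarrow> nat \<Rightarrow> nat"
    where "\<forall>a b. a \<le> b \<longrightarrow> b \<le> N \<longrightarrow> (\<Sum>i<Suc a. \<Sum>j = Suc b..Suc N. m i j) = r a b"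
    by (elim exE)
  then have m: "(\<Sum>i<Suc a. \<Sum>j = Suc b..Suc N. m i j) = r a b" if "a \<le> b" "b \<le> N" for a b
    using that by blast
  define M where "M = (\<Sum>x\<in>bar_index N. replicate_mset (case_prod m x) (bar N x))"
  have count: "count M (bar N (i, j)) = m i j" if "(i, j) \<in> bar_index N" for i j
  proof -
    \<comment> \<open>Injectivity of \<open>bar N\<close> leaves only the summand with index
      \<open>(i, j)\<close>.\<close>
    have "count M (bar N (i, j)) = (\<Sum>x\<in>bar_index N. if x = (i, j) then case_prod m x else 0)"
      unfolding M_def count_sum
      by (intro sum.cong) (use that inj_on_bar in \<open>auto simp: inj_on_def\<close>)
    then show ?thesis using that by simp
  qed
  have sub: "set_mset M \<subseteq> barcode_intervals N"
    by (auto simp: M_def barcode_intervals_eq set_mset_sum split: if_splits)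
  show ?thesis
  proof (rule ex1I[of _ M])
    have "r i j = size {#I \<in># M. {real i..real j} \<subseteq> I#}" if "i \<le> j" "j \<le> N" for i j
      unfolding size_filter_barcode[OF sub that] m[OF that, symmetric]
      by (intro sum.cong refl count[symmetric]) (use that in \<open>auto simp: bar_index_def\<close>)
    then show "?P M" using sub by simp
  next
    fix M' assume M': "?P M'"
    have "count M' I = count M I" for I
    proof (cases "I \<in> barcode_intervals N")
      case True
      then obtain i j where ij: "i < j" "j \<le> Suc N" and I: "I = bar N (i, j)"
        by (auto simp: barcode_intervals_eq bar_index_def)
      have "count M' (bar N (i, j)) = m i j"
      proof (rule rectangle_sum_determines[OF _ ij])
        fix a b assume ab: "a \<le> b" "b \<le> N"
        show "(\<Sum>i<Suc a. \<Sum>j = Suc b..Suc N. count M' (bar N (i, j)))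
            = (\<Sum>i<Suc a. \<Sum>j = Suc b..Suc N. m i j)"
          using M' ab by (simp only: m[OF ab] size_filter_barcode[OF _ ab, symmetric]) 
      qed
      then show ?thesis using ij count by (simp add: I bar_index_def)
    next
      case False
      then have "I \<notin># M'" "I \<notin># M" using conjunct1[OF M'] sub by blast+
      then show ?thesis by (simp add: not_in_iff)
    qed
    then show "M' = M" by (rule multiset_eqI)
  qed
qed

section \<open>Ranks of persistence modules\<close>

context vectorspace
begin

text \<open>Independent sets of the subspace remain independent in the whole space, which bounds
  their size by \<open>dim\<close>; a maximal one therefore exists and is a finite basis.\<close>

lemma subspace_fin_dim:
  assumes "subspace K A V" and fin_dim
  shows "vectorspace.fin_dim K (vs A)"
proof -
  interpret A: vectorspace K "vs A" using assms(1) by (rule subspace_is_vs)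
  have sub: "submodule K A V" using assms(1) by (rule is_module)
  have AV: "A \<subseteq> carrier V" using submodule.subset[OF sub] .
  have "\<exists>S. finite S \<and> maximal S (\<lambda>S. S \<subseteq> carrier (vs A) \<and> A.lin_indpt S)"
  proof (rule maximal_exists)
    fix S assume "S \<subseteq> carrier (vs A) \<and> A.lin_indpt S"
    then show "finite S \<and> card S \<le> dim"
      using AV li_le_dim[OF \<open>fin_dim\<close>, of S] span_li_not_depend(2)[OF _ sub, of S] by auto
  next
    show "{} \<subseteq> carrier (vs A) \<and> A.lin_indpt {}" by (auto simp: A.lin_dep_def)
  qed
  then obtain S where "finite S" "maximal S (\<lambda>S. S \<subseteq> carrier (vs A) \<and> A.lin_indpt S)" by blast
  then have "finite S" "A.basis S" by (simp_all only: A.max_li_is_basis)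
  then show ?thesis unfolding A.fin_dim_def A.basis_def by blast
qed

lemma subspace_dim_mono:
  assumes "subspace K A V" "subspace K B V" "A \<subseteq> B" and fin_dim
  shows "vectorspace.dim K (vs A) \<le> vectorspace.dim K (vs B)"
proof -
  interpret B: vectorspace K "vs B" using assms(2) by (rule subspace_is_vs)
  have "subspace K A (vs B)" using assms by (intro nested_subspaces)
  then show ?thesis
    using B.subspace_dim[of A] subspace_fin_dim assms by simp
qed

end

lemma linear_mapI:
  assumes "vectorspace K V" "vectorspace K W" "T \<in> module_hom K V W"
  shows "linear_map K V W T"
  using assms
  by (intro linear_map.intro mod_hom.intro mod_hom_axioms.intro) (auto dest: vectorspace.axioms(1))

context linear_map
begin

lemma linear_map_subspace:
  assumes "subspace K A V"
  shows "linear_map K (V.vs A) W T"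
proof -
  have A: "A \<subseteq> carrier V" using submodule.subset[OF V.is_module[OF assms]] .
  have "vectorspace K (V.vs A)" using assms by (rule V.subspace_is_vs)
  moreover have "T \<in> module_hom K (V.vs A) W"
    using A by (auto simp: module_hom_def Pi_iff subset_iff)
  ultimately show ?thesis
    by (intro linear_mapI W.vectorspace_axioms)
qed

lemma image_subspace:
  assumes "subspace K A V"
  shows "subspace K (T ` A) W"
proof -
  interpret A: linear_map K "V.vs A" W T using assms by (rule linear_map_subspace)
  show ?thesis using A.imT_is_subspace by (simp add: A.im_def)
qed

text \<open>This is rank-nullity for the restriction of \<open>T\<close> to \<open>A\<close>, whose
  kernel is \<open>A \<inter> kerT\<close>.\<close>

lemma rank_nullity_subspace:
  assumes "subspace K A V" and "V.fin_dim"
  shows "vectorspace.dim K (W.vs (T ` A)) + vectorspace.dim K (V.vs (A \<inter> kerT)) = vectorspace.dim K (V.vs A)"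
proof -
  interpret A: linear_map K "V.vs A" W T using assms(1) by (rule linear_map_subspace)
  have A: "A \<subseteq> carrier V" using submodule.subset[OF V.is_module[OF assms(1)]] .
  have "A.ker = A \<inter> kerT" using A by (auto simp: A.ker_def ker_def)
  then show ?thesis
    using A.rank_nullity V.subspace_fin_dim[OF assms] by (simp add: A.im_def)
qed

lemma dim_image_le:
  assumes "subspace K A V" and "V.fin_dim"
  shows "vectorspace.dim K (W.vs (T ` A)) \<le> vectorspace.dim K (V.vs A)"
  using rank_nullity_subspace[OF assms] by simp

text \<open>By rank-nullity this says that the kernel of \<open>T\<close> on \<open>A\<close> is at most as large as that on \<open>B\<close>.\<close>

lemma dim_image_drop_mono:
  assumes A: "subspace K A V" and B: "subspace K B V" and "A \<subseteq> B" and fd: "V.fin_dim"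
  shows "vectorspace.dim K (V.vs A) + vectorspace.dim K (W.vs (T ` B))
    \<le> vectorspace.dim K (V.vs B) + vectorspace.dim K (W.vs (T ` A))"
proof -
  have ker: "subspace K (C \<inter> kerT) V" if "subspace K C V" for C
  proof -
    interpret C: linear_map K "V.vs C" W T using that by (rule linear_map_subspace)
    have C: "submodule K C V" using that by (rule V.is_module)
    have "submodule K (C \<inter> kerT) V"
      using submodule.subset[OF C] submodule.zero_closed[OF C] submodule.m_closed[OF C]
        submodule.smult_closed[OF C]
      by (intro submodule.intro vectorspace.axioms(1)[OF V.vectorspace_axioms]) (auto simp: ker_def)
    then show ?thesis by (simp add: subspace_def V.vectorspace_axioms)
  qed
  have "vectorspace.dim K (V.vs (A \<inter> kerT)) \<le> vectorspace.dim K (V.vs (B \<inter> kerT))"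
    using \<open>A \<subseteq> B\<close> ker A B fd by (intro V.subspace_dim_mono) auto
  then show ?thesis
    using rank_nullity_subspace[OF A fd] rank_nullity_subspace[OF B fd] by linarith
qed

end

text \<open>The linear algebra, separated from the topology. The three rank inequalities hold
  because dimension cannot grow under a linear map, because the image of \<open>U a\<close> lies in
  that of \<open>U (Suc a)\<close>, and because the loss of dimension under a map is monotone in the
  subspace.\<close>

theorem persistence_barcode_ex1:
  fixes H :: "nat \<Rightarrow> ('k::field, 'v) module" and U :: "nat \<Rightarrow> 'v set"
    and F :: "nat \<Rightarrow> nat \<Rightarrow> 'v \<Rightarrow> 'v"
  assumes lin: "\<And>i j. i \<le> j \<Longrightarrow> j \<le> N \<Longrightarrow> linear_map class_ring (H i) (H j) (F i j)"
    and fd: "\<And>i. i \<le> N \<Longrightarrow> vectorspace.fin_dim class_ring (H i)"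
    and sub: "\<And>i. i \<le> N \<Longrightarrow> subspace class_ring (U i) (H i)"
    and comp: "\<And>i j k x. i \<le> j \<Longrightarrow> j \<le> k \<Longrightarrow> k \<le> N \<Longrightarrow> x \<in> U i \<Longrightarrow> F j k (F i j x) = F i k x"
    and U: "\<And>i j. i \<le> j \<Longrightarrow> j \<le> N \<Longrightarrow> F i j ` U i \<subseteq> U j"
  shows "\<exists>!M. set_mset M \<subseteq> barcode_intervals N \<and>
    (\<forall>i j. i \<le> j \<and> j \<le> N \<longrightarrow>
      subspace_dim (H j) (F i j ` U i) = size {#I \<in># M. {real i..real j} \<subseteq> I#})"
proof (rule barcode_ex1)
  have img: "F j k ` F i j ` U i = F i k ` U i" if "i \<le> j" "j \<le> k" "k \<le> N" for i j k
    using comp[OF that] by (auto simp: image_image intro!: image_cong)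
  have subF: "subspace class_ring (F i j ` U i) (H j)" if "i \<le> j" "j \<le> N" for i j
    using that by (intro linear_map.image_subspace[OF lin] sub) auto
  {
    fix b assume b: "b < N"
    then show "subspace_dim (H (Suc b)) (F 0 (Suc b) ` U 0) \<le> subspace_dim (H b) (F 0 b ` U 0)"
      using linear_map.dim_image_le[OF lin[of b "Suc b"] subF fd, of 0] img[of 0 b "Suc b"]
      by (simp add: subspace_dim_def)
  next
    fix a assume a: "a < N"
    have "F a N ` U a \<subseteq> F (Suc a) N ` U (Suc a)"
      using img[of a "Suc a" N] U[of a "Suc a"] a by auto
    then show "subspace_dim (H N) (F a N ` U a) \<le> subspace_dim (H N) (F (Suc a) N ` U (Suc a))"
      unfolding subspace_dim_def using a
      by (intro vectorspace.subspace_dim_mono subF fd subspace.vs[OF sub]) auto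
  next
    fix a b assume ab: "a < b" "b < N"
    \<comment> \<open>These are nested subspaces of \<open>H b\<close>; \<open>F b (Suc b)\<close>
      loses at most as much dimension on the smaller as on the larger.\<close>
    have "F a b ` U a \<subseteq> F (Suc a) b ` U (Suc a)"
      using img[of a "Suc a" b] U[of a "Suc a"] ab by auto
    then show "subspace_dim (H (Suc b)) (F (Suc a) (Suc b) ` U (Suc a)) + subspace_dim (H b) (F a b ` U a)
      \<le> subspace_dim (H b) (F (Suc a) b ` U (Suc a)) + subspace_dim (H (Suc b)) (F a (Suc b) ` U a)"
      using linear_map.dim_image_drop_mono[OF lin[of b "Suc b"] subF[of a b] subF[of "Suc a" b] _ fd]
        img[of a b "Suc b"] img[of "Suc a" b "Suc b"] ab
      by (simp add: subspace_dim_def)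
  }
qed

section \<open>Linear maps out of free vector spaces\<close>

text \<open>The support varies with \<open>x\<close>; a fixed finite index set lets values at
  different arguments be compared termwise.\<close>

lemma lin_ext_superset:
  assumes "finite S" "Poly_Mapping.keys x \<subseteq> S"
  shows "lin_ext \<phi> x = (\<Sum>s\<in>S. pm_scale (Poly_Mapping.lookup x s) (\<phi> s))"
  unfolding lin_ext_def using assms
  by (intro sum.mono_neutral_left) (auto simp: in_keys_iff pm_scale_simps)

lemma lin_ext_0 [simp]: "lin_ext \<phi> 0 = 0"
  by (simp add: lin_ext_def)

lemma lin_ext_single [simp]: "lin_ext \<phi> (Poly_Mapping.single s c) = pm_scale c (\<phi> s)"
  by (simp add: lin_ext_def pm_scale_simps)

lemma lin_ext_add: "lin_ext \<phi> (x + y) = lin_ext \<phi> x + lin_ext \<phi> y"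
proof -
  let ?S = "Poly_Mapping.keys x \<union> Poly_Mapping.keys y"
  have "Poly_Mapping.keys (x + y) \<subseteq> ?S" by (rule keys_add)
  then show ?thesis
    by (simp add: lin_ext_superset[of ?S] lookup_add pm_scale_simps sum.distrib)
qed

lemma lin_ext_scale: "lin_ext \<phi> (pm_scale c x) = pm_scale c (lin_ext \<phi> x)"
  using keys_pm_scale[of c x]
  by (simp add: lin_ext_superset[of "Poly_Mapping.keys x"] pm_scale_sum pm_scale_simps)

lemma lin_ext_sum: "lin_ext \<phi> (sum f A) = (\<Sum>a\<in>A. lin_ext \<phi> (f a))"
  by (induction A rule: infinite_finite_induct) (simp_all add: lin_ext_add)

lemma lin_ext_lin_ext: "lin_ext \<phi> (lin_ext \<psi> x) = lin_ext (\<lambda>s. lin_ext \<phi> (\<psi> s)) x"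
  by (subst (2 3) lin_ext_def) (simp add: lin_ext_sum lin_ext_scale)

lemma lin_ext_cong: "(\<And>s. s \<in> Poly_Mapping.keys x \<Longrightarrow> \<phi> s = \<psi> s) \<Longrightarrow> lin_ext \<phi> x = lin_ext \<psi> x"
  by (simp add: lin_ext_def)

lemma lin_ext_eq_0: "(\<And>s. s \<in> Poly_Mapping.keys x \<Longrightarrow> \<phi> s = 0) \<Longrightarrow> lin_ext \<phi> x = 0"
  by (simp add: lin_ext_def pm_scale_simps)

lemma lin_ext_single_id: "lin_ext (\<lambda>s. Poly_Mapping.single s 1) x = x"
  by (rule poly_mapping_eqI)
    (simp add: lin_ext_def lookup_sum pm_scale_simps lookup_single when_def in_keys_iff)

lemma keys_sum_subset:
  assumes "\<And>a. a \<in> A \<Longrightarrow> Poly_Mapping.keys (f a) \<subseteq> T"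
  shows "Poly_Mapping.keys (sum f A) \<subseteq> T"
  using assms by (induction A rule: infinite_finite_induct) (auto dest!: keys_add[THEN subsetD])

lemma lin_ext_module_hom:
  assumes "\<And>s. s \<in> S \<Longrightarrow> Poly_Mapping.keys (\<phi> s) \<subseteq> T"
  shows "lin_ext \<phi> \<in> module_hom class_ring (free_vs S) (free_vs T)"
proof -
  have "Poly_Mapping.keys (lin_ext \<phi> x) \<subseteq> T" if "Poly_Mapping.keys x \<subseteq> S" for x
    unfolding lin_ext_def
  proof (rule keys_sum_subset)
    fix s assume "s \<in> Poly_Mapping.keys x"
    then show "Poly_Mapping.keys (pm_scale (Poly_Mapping.lookup x s) (\<phi> s)) \<subseteq> T"
      using that by (intro subset_trans[OF keys_pm_scale assms]) auto
  qed
  then show ?thesis by (auto simp: module_hom_def lin_ext_add lin_ext_scale)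
qed

section \<open>Homology of chain complexes\<close>

locale chain_complex =
  fixes C :: "('k::field, 'v) graded" and d :: "int \<Rightarrow> 'v \<Rightarrow> 'v"
  assumes C_vectorspace: "\<And>p. vectorspace class_ring (C p)"
    and d_hom: "\<And>p. d p \<in> module_hom class_ring (C p) (C (p - 1))"
    and d_d: "\<And>p x. x \<in> carrier (C p) \<Longrightarrow> d (p - 1) (d p x) = \<zero>\<^bsub>C (p - 1 - 1)\<^esub>"
begin

lemma d_linear: "linear_map class_ring (C p) (C (p - 1)) (d p)"
  by (intro linear_mapI C_vectorspace d_hom)

abbreviation cycle_space :: "int \<Rightarrow> ('k, 'v) module" where
  "cycle_space p \<equiv> C p\<lparr>carrier := cycles C d p\<rparr>"

lemma cycles_subspace: "subspace class_ring (cycles C d p) (C p)"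
proof -
  interpret linear_map class_ring "C p" "C (p - 1)" "d p" by (rule d_linear)
  show ?thesis using kerT_is_subspace by (simp add: ker_def cycles_def lin_ker_def)
qed

lemma boundaries_subspace: "subspace class_ring (boundaries C d p) (C p)"
proof -
  interpret linear_map class_ring "C (p + 1)" "C p" "d (p + 1)" using d_linear[of "p + 1"] by simp
  show ?thesis using imT_is_subspace by (simp add: im_def boundaries_def)
qed

lemma boundaries_subset_cycles: "boundaries C d p \<subseteq> cycles C d p"
proof -
  have "boundaries C d p \<subseteq> carrier (C p)"
    using boundaries_subspace[of p] submodule.subset unfolding subspace_def by blast
  then show ?thesis
    using d_d[of _ "p + 1"] by (auto simp: boundaries_def cycles_def lin_ker_def)
qed

lemma cycle_space_vectorspace: "vectorspace class_ring (cycle_space p)"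
  by (rule vectorspace.subspace_is_vs[OF C_vectorspace cycles_subspace])

lemma boundaries_submodule: "submodule class_ring (boundaries C d p) (cycle_space p)"
  using vectorspace.nested_subspaces[OF C_vectorspace cycles_subspace boundaries_subspace
      boundaries_subset_cycles]
  by (simp add: subspace_def)

lemma boundaries_abelian_subgroup: "abelian_subgroup (boundaries C d p) (cycle_space p)"
  by (rule module.submodule_abelian_subgroup[OF vectorspace.axioms(1)[OF cycle_space_vectorspace]
        boundaries_submodule])

lemma homology_vectorspace: "vectorspace class_ring (homology_vs C d p)"
  unfolding homology_vs_def
  by (rule vectorspace.quot_vs_vectorspace[OF cycle_space_vectorspace boundaries_submodule])

definition homology_class :: "int \<Rightarrow> 'v \<Rightarrow> 'v set" where
  "homology_class p z = boundaries C d p +>\<^bsub>cycle_space p\<^esub> z"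

lemma carrier_homology: "carrier (homology_vs C d p) = homology_class p ` cycles C d p"
  by (simp add: homology_vs_def carrier_quot_vs homology_class_def)

lemma add_homology_class:
  assumes "x \<in> cycles C d p" "y \<in> cycles C d p"
  shows "homology_class p x \<oplus>\<^bsub>homology_vs C d p\<^esub> homology_class p y = homology_class p (x \<oplus>\<^bsub>C p\<^esub> y)"
  using vectorspace.add_quot_vs[OF cycle_space_vectorspace boundaries_submodule] assms
  by (simp add: homology_vs_def homology_class_def)

lemma smult_homology_class:
  assumes "x \<in> cycles C d p"
  shows "c \<odot>\<^bsub>homology_vs C d p\<^esub> homology_class p x = homology_class p (c \<odot>\<^bsub>C p\<^esub> x)"
  using vectorspace.smult_quot_vs[OF cycle_space_vectorspace boundaries_submodule] assms
  by (simp add: homology_vs_def homology_class_def)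

end

section \<open>Chain maps and the maps they induce in homology\<close>

locale chain_map = X: chain_complex C d + Y: chain_complex C' d'
  for C :: "('k::field, 'v) graded" and d and C' :: "('k, 'w) graded" and d' +
  fixes f :: "int \<Rightarrow> 'v \<Rightarrow> 'w"
  assumes f_hom: "\<And>p. f p \<in> module_hom class_ring (C p) (C' p)"
    and f_d: "\<And>p x. x \<in> carrier (C p) \<Longrightarrow> d' p (f p x) = f (p - 1) (d p x)"
begin

lemma f_cycles: "x \<in> cycles C d p \<Longrightarrow> f p x \<in> cycles C' d' p"
proof -
  assume x: "x \<in> cycles C d p"
  have "linear_map class_ring (C (p - 1)) (C' (p - 1)) (f (p - 1))"
    by (intro linear_mapI X.C_vectorspace Y.C_vectorspace f_hom)
  then have "f (p - 1) \<zero>\<^bsub>C (p - 1)\<^esub> = \<zero>\<^bsub>C' (p - 1)\<^esub>"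
    by (rule linear_map.T0_is_0)
  then show ?thesis
    using x f_d[of x p] module_hom_closed[OF f_hom[of p]] by (auto simp: cycles_def lin_ker_def)
qed

text \<open>A chain map sends boundaries to boundaries, so this is the coset lemma for the
  boundaries inside the spaces of cycles.\<close>

lemma homology_map_class:
  assumes "x \<in> cycles C d p"
  shows "homology_map C' d' f p (X.homology_class p x) = Y.homology_class p (f p x)"
proof -
  have "f p (d (p + 1) y) \<in> boundaries C' d' p" if "y \<in> carrier (C (p + 1))" for y
    using that f_d[of y "p + 1"] module_hom_closed[OF f_hom[of "p + 1"]]
    by (auto simp: boundaries_def intro!: image_eqI[of _ _ "f (p + 1) y"])
  then have "f p ` boundaries C d p \<subseteq> boundaries C' d' p" by (auto simp: boundaries_def)
  moreover have "f p \<in> carrier (X.cycle_space p) \<rightarrow> carrier (Y.cycle_space p)"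
    using f_cycles by auto
  moreover have "f p (y \<oplus>\<^bsub>C p\<^esub> z) = f p y \<oplus>\<^bsub>C' p\<^esub> f p z" if "y \<in> cycles C d p" "z \<in> cycles C d p" for y z
    using that module_hom_add[OF f_hom[of p], of y z] by (auto simp: cycles_def lin_ker_def)
  ultimately have "boundaries C' d' p <+>\<^bsub>Y.cycle_space p\<^esub> f p ` X.homology_class p x = Y.homology_class p (f p x)"
    using assms unfolding X.homology_class_def Y.homology_class_def
    by (intro set_add_image_coset X.boundaries_abelian_subgroup Y.boundaries_abelian_subgroup) auto
  \<comment> \<open>\<open>homology_map\<close> forms the sum in \<open>C' p\<close>, the coset
    lemma in the cycle space; the two records share their addition.\<close>
  then show ?thesis by (simp add: homology_map_def set_add_def')
qed

lemma homology_map_linear: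
  "linear_map class_ring (homology_vs C d p) (homology_vs C' d' p) (homology_map C' d' f p)"
proof -
  have Z: "cycles C d p \<subseteq> carrier (C p)" by (auto simp: cycles_def lin_ker_def)
  have sub: "submodule class_ring (cycles C d p) (C p)"
    using X.cycles_subspace[of p] by (simp add: subspace_def)
  note closed = submodule.m_closed[OF sub] submodule.smult_closed[OF sub]
  have "homology_map C' d' f p \<in> module_hom class_ring (homology_vs C d p) (homology_vs C' d' p)"
    unfolding module_hom_def
    using Z f_cycles module_hom_add[OF f_hom[of p]] module_hom_smult[OF f_hom[of p]]
    by (auto simp: X.carrier_homology Y.carrier_homology X.add_homology_class X.smult_homology_class
        homology_map_class closed Y.add_homology_class Y.smult_homology_class subset_iff)
  then show ?thesis
    by (intro linear_mapI X.homology_vectorspace Y.homology_vectorspace)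
qed

end

section \<open>Singular chains\<close>

text \<open>That the boundary squares to zero is inherited from the integral chains of \<^theory>\<open>HOL-Homology.Simplices\<close>.\<close>

definition pm_of_int :: "('s \<Rightarrow>\<^sub>0 int) \<Rightarrow> ('s \<Rightarrow>\<^sub>0 'k::field)" where
  "pm_of_int = Poly_Mapping.map of_int"

lemma lookup_pm_of_int [simp]: "Poly_Mapping.lookup (pm_of_int x) s = of_int (Poly_Mapping.lookup x s)"
  by (simp add: pm_of_int_def Poly_Mapping.map.rep_eq when_def)

lemma pm_of_int_simps:
  "pm_of_int 0 = 0" "pm_of_int (x + y) = pm_of_int x + pm_of_int y"
  "pm_of_int (frag_cmul a x) = pm_scale (of_int a) (pm_of_int x)"
  "pm_of_int (frag_of s) = Poly_Mapping.single s 1"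
  by (auto intro!: poly_mapping_eqI simp: lookup_add lookup_single when_def)

lemma pm_of_int_sum: "pm_of_int (sum f A) = (\<Sum>a\<in>A. pm_of_int (f a))"
  by (induction A rule: infinite_finite_induct) (simp_all add: pm_of_int_simps)

definition simplex_bd :: "nat \<Rightarrow> ((nat \<Rightarrow> real) \<Rightarrow> 'a) \<Rightarrow> ('k::field, 'a) sing" where
  "simplex_bd p \<sigma> = (\<Sum>k\<le>p. Poly_Mapping.single (singular_face p k \<sigma>) ((- 1) ^ k))"

lemma sing_bd_eq: "sing_bd p c = (if p \<le> 0 then 0 else lin_ext (simplex_bd (nat p)) c)"
  by (simp add: sing_bd_def simplex_bd_def[abs_def])

text \<open>Passing to coefficients in \<open>'k\<close> commutes with the boundary. Degree 0 is
  excluded because \<open>chain_boundary\<close> is zero there, whereas \<open>simplex_bd 0\<close>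
  is a single term with coefficient 1.\<close>

lemma pm_of_int_chain_boundary:
  assumes "p \<noteq> 0"
  shows "pm_of_int (chain_boundary p c) = lin_ext (simplex_bd p) (pm_of_int c :: ('k::field, 'a) sing)"
proof -
  have "pm_of_int (chain_boundary p c) =
      (\<Sum>s\<in>Poly_Mapping.keys c. pm_scale (of_int (Poly_Mapping.lookup c s)) (simplex_bd p s :: ('k, 'a) sing))"
    using assms by (simp add: chain_boundary_def frag_extend_def simplex_bd_def pm_of_int_sum
        pm_of_int_simps pm_scale_simps)
  also have "\<dots> = lin_ext (simplex_bd p) (pm_of_int c)"
    \<comment> \<open>The sum runs over the keys of \<open>c\<close>, since in positive
      characteristic \<open>pm_of_int\<close> may kill some of its coefficients.\<close>
    by (subst lin_ext_superset[of "Poly_Mapping.keys c"]) (auto simp: in_keys_iff)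
  finally show ?thesis .
qed

lemma simplex_bd_simplex_bd:
  assumes "singular_simplex (Suc (Suc p)) X \<sigma>"
  shows "lin_ext (simplex_bd (Suc p)) (simplex_bd (Suc (Suc p)) \<sigma>) = (0 :: ('k::field, 'a) sing)"
proof -
  have *: "simplex_bd (Suc (Suc p)) \<sigma> = (pm_of_int (chain_boundary (Suc (Suc p)) (frag_of \<sigma>)) :: ('k, 'a) sing)"
    by (simp add: pm_of_int_chain_boundary pm_of_int_simps pm_scale_simps)
  have "singular_chain (Suc (Suc p)) X (frag_of \<sigma>)"
    using assms by (simp add: singular_chain_def)
  from chain_boundary_boundary_alt[OF this] show ?thesis
    by (simp add: * pm_of_int_chain_boundary[symmetric] pm_of_int_simps)
qed

lemma sing_chains_vectorspace: "vectorspace class_ring (sing_chains X p)"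
  by (simp add: sing_chains_def free_vs_vectorspace)

lemma keys_simplex_bd:
  assumes "0 < p" "singular_simplex (nat p) X \<sigma>"
  shows "Poly_Mapping.keys (simplex_bd (nat p) \<sigma>) \<subseteq> {\<sigma>. 0 \<le> p - 1 \<and> singular_simplex (nat (p - 1)) X \<sigma>}"
  unfolding simplex_bd_def
proof (rule keys_sum_subset)
  fix k assume "k \<in> {..nat p}"
  then have "singular_simplex (nat (p - 1)) X (singular_face (nat p) k \<sigma>)"
    using singular_simplex_singular_face[OF assms(2), of k] assms(1) by (simp add: nat_diff_distrib)
  then show "Poly_Mapping.keys (Poly_Mapping.single (singular_face (nat p) k \<sigma>) ((- 1) ^ k))
      \<subseteq> {\<sigma>. 0 \<le> p - 1 \<and> singular_simplex (nat (p - 1)) X \<sigma>}"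
    using assms(1) by simp
qed

lemma sing_bd_hom: "sing_bd p \<in> module_hom class_ring (sing_chains X p) (sing_chains X (p - 1))"
proof (cases "p \<le> 0")
  case True
  then show ?thesis by (auto simp: module_hom_def sing_chains_def sing_bd_eq pm_scale_simps)
next
  case False
  then have eq: "sing_bd p = lin_ext (simplex_bd (nat p))" by (auto simp: sing_bd_eq)
  show ?thesis
    unfolding sing_chains_def eq
  proof (rule lin_ext_module_hom)
    fix \<sigma> assume "\<sigma> \<in> {\<sigma>. 0 \<le> p \<and> singular_simplex (nat p) X \<sigma>}"
    then show "Poly_Mapping.keys (simplex_bd (nat p) \<sigma>) \<subseteq> {\<sigma>. 0 \<le> p - 1 \<and> singular_simplex (nat (p - 1)) X \<sigma>}"
      using False by (intro keys_simplex_bd) auto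
  qed
qed

lemma sing_bd_sing_bd:
  assumes "x \<in> carrier (sing_chains X p)"
  shows "sing_bd (p - 1) (sing_bd p x) = 0"
\<comment> \<open>For \<open>p \<le> 1\<close> the outer boundary is zero by definition; otherwise
  both degrees are positive.\<close>
proof (cases "p \<le> 1")
  case False
  then obtain q where p: "nat p = Suc (Suc q)" "nat (p - 1) = Suc q"
    by (intro that[of "nat (p - 2)"]) linarith+
  then show ?thesis
    using assms False by (auto simp: sing_bd_eq lin_ext_lin_ext sing_chains_def subset_iff
        intro!: lin_ext_eq_0 simplex_bd_simplex_bd[of _ X])
qed (auto simp: sing_bd_eq)

lemma sing_chain_complex: "chain_complex (sing_chains X) sing_bd"
  using sing_chains_vectorspace sing_bd_hom sing_bd_sing_bd
  by (intro chain_complex.intro) (auto simp: sing_chains_def)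

section \<open>Chain maps induced by continuous maps\<close>

definition sing_chain_map :: "('a \<Rightarrow> 'b) \<Rightarrow> int \<Rightarrow> ('k::field, 'a) sing \<Rightarrow> ('k, 'b) sing" where
  "sing_chain_map g p = lin_ext (\<lambda>\<sigma>. Poly_Mapping.single (simplex_map (nat p) g \<sigma>) 1)"

text \<open>Faces precompose and \<open>simplex_map\<close> postcomposes; the restrictions to
  standard simplices agree because the face inclusion maps one simplex into the other.\<close>

lemma singular_face_simplex_map_commute:
  assumes "1 \<le> p" "k \<le> p"
  shows "singular_face p k (simplex_map p f \<sigma>) = simplex_map (p - 1) f (singular_face p k \<sigma>)"
  using assms by (fastforce simp: singular_face_def simplex_map_def simplical_face_in_standard_simplex)

lemma sing_chain_map:
  assumes "continuous_map X Y g"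
  shows "chain_map (sing_chains X) sing_bd (sing_chains Y) sing_bd (sing_chain_map g)"
proof -
  have "sing_chain_map g p \<in> module_hom class_ring (sing_chains X p) (sing_chains Y p)" for p
    unfolding sing_chains_def sing_chain_map_def using assms
    by (intro lin_ext_module_hom) (auto intro: singular_simplex_simplex_map)
  moreover have "sing_bd p (sing_chain_map g p x) = sing_chain_map g (p - 1) (sing_bd p x)" for p x
    by (cases "p \<le> 0")
      (auto simp: sing_bd_eq sing_chain_map_def lin_ext_lin_ext simplex_bd_def lin_ext_sum
        pm_scale_simps singular_face_simplex_map_commute nat_diff_distrib intro!: lin_ext_cong sum.cong)
  ultimately show ?thesis
    by (intro chain_map.intro chain_map_axioms.intro sing_chain_complex)
qed

section \<open>The barcode of the kernels\<close>

lemma sing_chain_map_compose: "sing_chain_map (h \<circ> g) p x = sing_chain_map h p (sing_chain_map g p x)"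
  by (simp add: sing_chain_map_def lin_ext_lin_ext simplex_map_compose pm_scale_simps)

text \<open>\<open>simplex_map\<close> restricts to the standard simplex, which changes nothing for
  genuine singular simplices; hence the carrier hypothesis.\<close>

lemma sing_chain_map_id:
  assumes "x \<in> carrier (sing_chains X p)"
  shows "sing_chain_map id p x = x"
proof -
  have "sing_chain_map id p x = lin_ext (\<lambda>\<sigma>. Poly_Mapping.single \<sigma> 1) x"
    unfolding sing_chain_map_def
    using assms simplex_map_id_gen[of "nat p" X _ id]
    by (intro lin_ext_cong) (auto simp: sing_chains_def simp del: simplex_map_id)
  then show ?thesis by (simp add: lin_ext_single_id)
qed

lemma sing_homology_vectorspace: "vectorspace class_ring (sing_homology X p)"
  unfolding sing_homology_def by (rule chain_complex.homology_vectorspace[OF sing_chain_complex])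

lemma persistence_map_eq:
  "persistence_map K g p i j =
    homology_map (sing_chains (K j)) sing_bd (sing_chain_map (fold g [i..<j])) (int p)"
  by (simp add: persistence_map_def sing_homology_map_def sing_chain_map_def[abs_def])

abbreviation sing_class :: "'a topology \<Rightarrow> int \<Rightarrow> ('k::field, 'a) sing \<Rightarrow> ('k, 'a) sing set" where
  "sing_class X \<equiv> chain_complex.homology_class (sing_chains X) sing_bd"

lemma carrier_sing_homology:
  "carrier (sing_homology X p) = sing_class X p ` cycles (sing_chains X) sing_bd p"
  unfolding sing_homology_def by (rule chain_complex.carrier_homology[OF sing_chain_complex])

text \<open>A tensor power shares addition and scaling with the tensor algebra and has a smaller
  carrier, so \<open>\<Delta> n p\<close> is a linear map into \<open>tensor_alg C\<close>, and its
  kernel is a subspace.\<close>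

lemma ainf_coalgebra_ker_subspace:
  assumes C: "\<And>p. vectorspace class_ring (C p)" and \<Delta>: "ainf_coalgebra C \<Delta>" and "n \<ge> 1"
  shows "subspace class_ring (lin_ker (C p) (tensor_alg C) (\<Delta> n p)) (C p)"
proof -
  have "\<Delta> n p \<in> module_hom class_ring (C p) (tensor_pow C n (p + int n - 2))"
    using \<Delta> \<open>n \<ge> 1\<close> by (simp add: ainf_coalgebra_def)
  moreover have "carrier (tensor_pow C m q) \<subseteq> carrier (tensor_alg C)" for m q
    by (auto simp: tensor_pow_def tensor_alg_def carrier_quot_vs tensor_class_def)
  moreover have "add (tensor_pow C m q) = add (tensor_alg C)" "smult (tensor_pow C m q) = smult (tensor_alg C)" for m q
    by (simp_all add: tensor_pow_def)
  ultimately have "\<Delta> n p \<in> module_hom class_ring (C p) (tensor_alg C)"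
    unfolding module_hom_def by (auto simp: Pi_iff subset_iff)
  then interpret linear_map class_ring "C p" "tensor_alg C" "\<Delta> n p"
    by (intro linear_mapI C tensor_alg_vectorspace)
  show ?thesis using kerT_is_subspace by (simp add: ker_def lin_ker_def)
qed

theorem theorem4p3:
  fixes K :: "nat \<Rightarrow> 'a topology" and g :: "nat \<Rightarrow> 'a \<Rightarrow> 'a"
    and \<Delta> :: "nat \<Rightarrow> nat \<Rightarrow> int \<Rightarrow> ('k::field, 'a) sing set \<Rightarrow> ('k, ('k, 'a) sing set) tensor"
    and N p n :: nat
  assumes "\<And>i. i < N \<Longrightarrow> continuous_map (K i) (K (Suc i)) (g i)"
    and "\<And>i q. i \<le> N \<Longrightarrow>
      vectorspace.fin_dim class_ring (sing_homology (K i) (int q) :: ('k, ('k, 'a) sing set) module)"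
    and "\<And>i. i \<le> N \<Longrightarrow> transferred_ainf (K i) (\<Delta> i)"
    and "n \<ge> 1"
    and "\<And>i. i < N \<Longrightarrow>
      persistence_map K g p i (Suc i) ` Delta_ker K \<Delta> n p i \<subseteq> Delta_ker K \<Delta> n p (Suc i)"
  shows "(\<exists>!M. is_Delta_barcode N K g \<Delta> n p M) \<and>
    (\<forall>M. is_Delta_barcode N K g \<Delta> n p M \<longrightarrow>
      (\<forall>i\<le>N. subspace_dim (sing_homology (K i) (int p)) (Delta_ker K \<Delta> n p i)
               = size {#I \<in># M. real i \<in> I#}))"
proof -
  let ?H = "\<lambda>i. sing_homology (K i) (int p) :: ('k, ('k, 'a) sing set) module"
  let ?U = "Delta_ker K \<Delta> n p"
  let ?F = "persistence_map K g p :: nat \<Rightarrow> nat \<Rightarrow> ('k, 'a) sing set \<Rightarrow> ('k, 'a) sing set"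
  let ?Z = "\<lambda>i. cycles (sing_chains (K i)) sing_bd (int p) :: ('k, 'a) sing set"
  have cont: "continuous_map (K i) (K j) (fold g [i..<j])" if "i \<le> j" "j \<le> N" for i j
    using that
  proof (induction j)
    case (Suc j)
    then show ?case
    proof (cases "i = Suc j")
      case False
      then show ?thesis
        using Suc assms(1)[of j] continuous_map_compose[of "K i" "K j" "fold g [i..<j]" "K (Suc j)" "g j"]
        by (auto simp: comp_def)
    qed (simp add: continuous_map_id[unfolded id_def] id_def)
  qed (simp add: id_def)
  have cm: "chain_map (sing_chains (K i)) sing_bd (sing_chains (K j)) sing_bd
      (sing_chain_map (fold g [i..<j]) :: int \<Rightarrow> ('k, 'a) sing \<Rightarrow> _)" if "i \<le> j" "j \<le> N" for i j
    by (intro sing_chain_map cont that)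
  have lin: "linear_map class_ring (?H i) (?H j) (?F i j)" if "i \<le> j" "j \<le> N" for i j
    unfolding sing_homology_def persistence_map_eq by (rule chain_map.homology_map_linear[OF cm[OF that]])
  have cls: "?F i j (sing_class (K i) (int p) z) =
      sing_class (K j) (int p) (sing_chain_map (fold g [i..<j]) (int p) z)"
    if "i \<le> j" "j \<le> N" "z \<in> ?Z i" for i j z
    unfolding persistence_map_eq by (rule chain_map.homology_map_class[OF cm[OF that(1,2)] that(3)])
  \<comment> \<open>Functoriality is checked on a representing cycle, where it holds already for
    chains.\<close>
  have F_comp: "?F j k (?F i j x) = ?F i k x"
    if ijk: "i \<le> j" "j \<le> k" "k \<le> N" and x: "x \<in> carrier (?H i)" for i j k x
  proof -
    obtain z where z: "z \<in> ?Z i" "x = sing_class (K i) (int p) z"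
      using x by (auto simp: carrier_sing_homology)
    have "[i..<k] = [i..<j] @ [j..<k]" using ijk upt_add_eq_append[of i j "k - j"] by simp
    then have "fold g [i..<k] = fold g [j..<k] \<circ> fold g [i..<j]" by simp
    then show ?thesis
      using ijk z chain_map.f_cycles[OF cm[of i j] z(1)]
      by (simp add: cls sing_chain_map_compose del: fold_append)
  qed
  have F_id: "?F i i x = x" if "i \<le> N" and x: "x \<in> carrier (?H i)" for i x
  proof -
    obtain z where z: "z \<in> ?Z i" "x = sing_class (K i) (int p) z"
      using x by (auto simp: carrier_sing_homology)
    then show ?thesis
      using \<open>i \<le> N\<close> sing_chain_map_id[of z "K i" "int p"]
      by (simp add: cls cycles_def lin_ker_def)
  qed
  have U_carrier: "?U i \<subseteq> carrier (?H i)" for i by (auto simp: Delta_ker_def lin_ker_def)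
  have U: "subspace class_ring (?U i) (?H i)" if "i \<le> N" for i
    unfolding Delta_ker_def using assms(3)[OF that] \<open>n \<ge> 1\<close>
    by (intro ainf_coalgebra_ker_subspace sing_homology_vectorspace) (auto simp: transferred_ainf_def)
  \<comment> \<open>The hypothesis on consecutive kernels is iterated along the sequence.\<close>
  have FU: "?F i j ` ?U i \<subseteq> ?U j" if "i \<le> j" "j \<le> N" for i j
    using that
  proof (induction j rule: dec_induct)
    case base
    then show ?case using F_id U_carrier by fastforce
  next
    case (step j)
    have "?F i (Suc j) x = ?F j (Suc j) (?F i j x)" if "x \<in> ?U i" for x
      using F_comp[of i j "Suc j" x] step that U_carrier by auto
    moreover have "?F i j ` ?U i \<subseteq> ?U j" "?F j (Suc j) ` ?U j \<subseteq> ?U (Suc j)"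
      using step assms(5)[of j] by auto
    ultimately show ?case by (simp add: image_subset_iff)
  qed
  \<comment> \<open>The intersection collapses to \<open>?U i\<close>: the index
    \<open>k = i\<close> gives one inclusion, since \<open>?F i i\<close> is the identity, and
    \<open>FU\<close> gives the other.\<close>
  have persistent: "Delta_persistent K g \<Delta> n p i j = ?F i j ` ?U i" if ij: "i \<le> j" "j \<le> N" for i j
  proof -
    have "(\<Inter>k\<in>{i..j}. lin_ker (?H i) (tensor_alg (sing_homology (K k)))
        (\<Delta> k n (int p) \<circ> ?F i k)) = ?U i" (is "?I = _")
    proof
      show "?I \<subseteq> ?U i"
      proof
        fix x assume "x \<in> ?I"
        then have "x \<in> lin_ker (?H i) (tensor_alg (sing_homology (K i))) (\<Delta> i n (int p) \<circ> ?F i i)"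
          using ij by (auto dest: INT_D[of _ _ _ i])
        then show "x \<in> ?U i"
          using ij F_id[of i x] by (simp add: Delta_ker_def lin_ker_def)
      qed
      show "?U i \<subseteq> ?I"
      proof
        fix x assume x: "x \<in> ?U i"
        have "?F i k x \<in> ?U k" if "k \<in> {i..j}" for k
          using FU[of i k] that ij x by auto
        then show "x \<in> ?I" using x by (auto simp: Delta_ker_def lin_ker_def)
      qed
    qed
    then show ?thesis by (simp add: Delta_persistent_def)
  qed
  have "\<exists>!M. set_mset M \<subseteq> barcode_intervals N \<and>
    (\<forall>i j. i \<le> j \<and> j \<le> N \<longrightarrow>
      subspace_dim (?H j) (?F i j ` ?U i) = size {#I \<in># M. {real i..real j} \<subseteq> I#})"
    using U_carrier
    by (intro persistence_barcode_ex1 lin assms(2) U F_comp FU) auto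
  moreover have "is_Delta_barcode N K g \<Delta> n p M \<longleftrightarrow> set_mset M \<subseteq> barcode_intervals N \<and>
    (\<forall>i j. i \<le> j \<and> j \<le> N \<longrightarrow>
      subspace_dim (?H j) (?F i j ` ?U i) = size {#I \<in># M. {real i..real j} \<subseteq> I#})" for M
    by (auto simp: is_Delta_barcode_def persistent)
  moreover have "subspace_dim (?H i) (?U i) = size {#I \<in># M. real i \<in> I#}"
    if M: "is_Delta_barcode N K g \<Delta> n p M" and i: "i \<le> N" for M i
  proof -
    \<comment> \<open>For \<open>j = i\<close> the interval \<open>{real i..real i}\<close> is a
      single point and the persistent group is the kernel itself.\<close>
    have "?F i i ` ?U i = ?U i" using F_id[OF i] U_carrier[of i] by (force simp: subset_iff)
    moreover have "subspace_dim (?H i) (Delta_persistent K g \<Delta> n p i i)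
        = size {#I \<in># M. {real i..real i} \<subseteq> I#}"
      using M i unfolding is_Delta_barcode_def by blast
    ultimately show ?thesis using persistent[of i i] i by simp
  qed
  ultimately show ?thesis by simp
qed

end
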